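(* Let $\varphi$ be a positive linear map on a unital $C^*$-algebra $\mathcal{A}$ and let $s>0$. The following are equivalent: (1) $r(\varphi)<s$; (2) there exists $w\ge0$ in $\mathcal{A}$ with $\varphi(w)=s(w-1)$; (3) there exists a strictly positive $v\in\mathcal{A}$ such that $\|\alpha_v^{-1}\circ\varphi\circ\alpha_v\|<s$; (4) there exists a positive map $\psi$ on $\mathcal{A}$ which is elementarily similar to $\varphi$ with $\|\psi\|<s$.
   Context: $r(\varphi)$ is the spectral radius of $\varphi$ as a bounded operator on $\mathcal{A}$, and $\|\cdot\|$ the operator norm. An element is strictly positive if it is positive and invertible. For $a\in\mathcal{A}$, $\alpha_a$ is the map $x\mapsto a^*xa$; for invertible $a$, $\alpha_a^{-1}$ denotes its inverse map $x\mapsto (a^* )^{-1}xa^{-1}$. A positive map $\varphi$ is elementarily similar to a positive map $\psi$ if there exists invertible $a\in\mathcal{A}$ with $\varphi=\alpha_a^{-1}\circ\psi\circ\alpha_a$. *)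

theory Defs
  imports "HOL-Analysis.Analysis"
begin

text \<open>A unital C*-algebra: a complex unital Banach algebra with involution satisfying
the C*-identity. Complex scalars are encoded by a central element ci with ci*ci = -1
(the element i*1), so complex scalar multiplication is (a + b i) x = (a 1 + b ci) x.\<close>

class cstar_algebra = real_normed_algebra_1 + banach +
  fixes cstar_adj :: "'a \<Rightarrow> 'a"
    and ci :: 'a
  assumes ci_sq: "ci * ci = - 1"
    and ci_central: "ci * x = x * ci"
    and adj_adj: "cstar_adj (cstar_adj x) = x"
    and adj_add: "cstar_adj (x + y) = cstar_adj x + cstar_adj y"
    and adj_scaleR: "cstar_adj (r *\<^sub>R x) = r *\<^sub>R cstar_adj x"
    and adj_ci: "cstar_adj ci = - ci"
    and adj_mult: "cstar_adj (x * y) = cstar_adj y * cstar_adj x"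
    and cstar_identity: "norm (cstar_adj x * x) = (norm x)\<^sup>2"

definition cscale :: "complex \<Rightarrow> 'a::cstar_algebra \<Rightarrow> 'a" where
  "cscale c x = (Re c *\<^sub>R 1 + Im c *\<^sub>R ci) * x"

definition cinvertible :: "'a::cstar_algebra \<Rightarrow> bool" where
  "cinvertible a \<longleftrightarrow> (\<exists>b. a * b = 1 \<and> b * a = 1)"

definition cinv :: "'a::cstar_algebra \<Rightarrow> 'a" where
  "cinv a = (THE b. a * b = 1 \<and> b * a = 1)"

definition elem_spectrum :: "'a::cstar_algebra \<Rightarrow> complex set" where
  "elem_spectrum x = {c. \<not> cinvertible (x - cscale c 1)}"

definition positive :: "'a::cstar_algebra \<Rightarrow> bool" where
  "positive x \<longleftrightarrow> cstar_adj x = x \<and> elem_spectrum x \<subseteq> {c. Im c = 0 \<and> 0 \<le> Re c}"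

definition strictly_positive :: "'a::cstar_algebra \<Rightarrow> bool" where
  "strictly_positive x \<longleftrightarrow> positive x \<and> cinvertible x"

definition clinear_map :: "('a::cstar_algebra \<Rightarrow> 'a) \<Rightarrow> bool" where
  "clinear_map f \<longleftrightarrow> (\<forall>x y. f (x + y) = f x + f y) \<and> (\<forall>c x. f (cscale c x) = cscale c (f x))"

definition positive_map :: "('a::cstar_algebra \<Rightarrow> 'a) \<Rightarrow> bool" where
  "positive_map f \<longleftrightarrow> clinear_map f \<and> (\<forall>x. positive x \<longrightarrow> positive (f x))"

definition op_spectrum :: "('a::cstar_algebra \<Rightarrow> 'a) \<Rightarrow> complex set" where
  "op_spectrum f = {c. \<not> bij (\<lambda>x. f x - cscale c x)}"

definition spectral_radius :: "('a::cstar_algebra \<Rightarrow> 'a) \<Rightarrow> real" where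
  "spectral_radius f = Sup (cmod ` op_spectrum f)"

definition alpha :: "'a::cstar_algebra \<Rightarrow> 'a \<Rightarrow> 'a" where
  "alpha a x = cstar_adj a * x * a"

definition alpha_inv :: "'a::cstar_algebra \<Rightarrow> 'a \<Rightarrow> 'a" where
  "alpha_inv a x = cstar_adj (cinv a) * x * cinv a"

definition elem_similar :: "('a::cstar_algebra \<Rightarrow> 'a) \<Rightarrow> ('a \<Rightarrow> 'a) \<Rightarrow> bool" where
  "elem_similar \<phi> \<psi> \<longleftrightarrow> (\<exists>a. cinvertible a \<and> \<phi> = alpha_inv a \<circ> \<psi> \<circ> alpha a)"

end

theory Submission
  imports Defs
begin

text \<open>If \<open>w \<ge> 0\<close> and \<open>\<phi>(w) = s (w - 1)\<close>, then \<open>w \<ge> 1\<close>, and conjugating by \<open>v = w\<^sup>1\<^sup>/\<^sup>2\<close> turns \<open>\<phi>\<close> into a positive map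
\<open>\<psi>\<close> with \<open>\<psi>(1) = s (1 - w\<^sup>-\<^sup>1) \<le> K\<close> for some \<open>K < s\<close>; by the Russo-Dye bound \<open>\<parallel>\<psi>\<parallel> \<le> K\<close>. That bound is obtained by
writing \<open>a\<close> with \<open>\<parallel>a\<parallel> < 1\<close> as a combination \<open>\<Sum> \<zeta>\<^sup>k R\<^sub>k\<close> over roots of unity of positive elements with sum close to \<open>1\<close>
(a discrete Poisson kernel).

Conversely, suppose every real \<open>r \<ge> s\<close> lies outside the spectrum of \<open>\<phi>\<close>. The set of such \<open>r\<close> with a positive resolvent
contains all large \<open>r\<close>; it is open to the left by the first part and the Neumann series, and closed because \<open>y = (\<mu> - \<phi>)\<^sup>-\<^sup>1 1\<close>
satisfies \<open>(r - \<phi>) y = 1 + (r - \<mu>) y \<ge> 0\<close> for \<open>r\<close> close to \<open>\<mu>\<close>. Hence it reaches \<open>s\<close>, which gives \<open>w\<close>. The same descent to \<open>0\<close>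
shows that the spectrum of \<open>\<phi>\<close> is not empty, so the supremum defining the spectral radius is not a junk value.

Positivity of an element is handled through \<open>\<exists>t. \<parallel>t - a\<parallel> \<le> t\<close>, which for self-adjoint \<open>a\<close> characterises squares of self-adjoint
elements and is visibly closed under sums and limits.\<close>

section \<open>Scalars, adjoints and inverses\<close>

abbreviation self_adj :: "'a::cstar_algebra \<Rightarrow> bool" where
  "self_adj x \<equiv> cstar_adj x = x"

abbreviation scal :: "complex \<Rightarrow> 'a::cstar_algebra" where
  "scal c \<equiv> cscale c 1"

lemma adj_zero [simp]: "cstar_adj (0::'a::cstar_algebra) = 0"
  using adj_scaleR[of 0 "0::'a"] by simp

lemma adj_one [simp]: "cstar_adj (1::'a::cstar_algebra) = 1"
  by (metis adj_adj adj_mult mult.right_neutral)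

lemma adj_minus: "cstar_adj (- x) = - cstar_adj (x::'a::cstar_algebra)"
  using adj_scaleR[of "-1" x] by simp

lemma adj_diff: "cstar_adj (x - y) = cstar_adj x - cstar_adj (y::'a::cstar_algebra)"
  using adj_add[of x "-y"] by (simp add: adj_minus)

lemmas adj_simps = adj_add adj_diff adj_minus adj_scaleR adj_mult adj_adj

lemma adj_sum: "cstar_adj (sum f A) = (\<Sum>i\<in>A. cstar_adj (f i :: 'a::cstar_algebra))"
  by (induction A rule: infinite_finite_induct) (auto simp: adj_add)

lemma adj_power: "cstar_adj (x ^ n) = cstar_adj (x::'a::cstar_algebra) ^ n"
  by (induction n) (auto simp: adj_mult power_commutes)

text \<open>The C*-identity and submultiplicativity give |y|^2 <= |y*| |y|. Cancelling |y| and
  taking both \<open>x\<close> and its adjoint for \<open>y\<close> yields equality.\<close>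

lemma norm_adj [simp]: "norm (cstar_adj x) = norm (x::'a::cstar_algebra)"
proof -
  have *: "norm y \<le> norm (cstar_adj y)" for y :: 'a
  proof (cases "y = 0")
    case False
    have "norm y * norm y \<le> norm (cstar_adj y) * norm y"
      using norm_mult_ineq[of "cstar_adj y" y] by (simp add: cstar_identity power2_eq_square)
    with False show ?thesis by simp
  qed simp
  from *[of x] *[of "cstar_adj x"] show ?thesis by (simp add: adj_adj)
qed

lemma norm_self_adj_square: "self_adj x \<Longrightarrow> norm (x * x) = (norm (x::'a::cstar_algebra))\<^sup>2"
  by (metis cstar_identity)

lemma bounded_linear_adj: "bounded_linear (cstar_adj :: 'a::cstar_algebra \<Rightarrow> 'a)"
  by (rule bounded_linear_intro[where K = 1]) (auto simp: adj_add adj_scaleR)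

lemma cscale_eq_scal_mult: "cscale c x = scal c * (x::'a::cstar_algebra)"
  by (simp add: cscale_def)

lemma scal_central: "x * scal c = scal c * (x::'a::cstar_algebra)"
  by (simp add: cscale_def algebra_simps ci_central)

lemma scal_of_real: "scal (of_real r) = r *\<^sub>R (1::'a::cstar_algebra)"
  by (simp add: cscale_def)

lemma scal_one [simp]: "scal 1 = (1::'a::cstar_algebra)"
  by (simp add: cscale_def)

lemma scal_zero [simp]: "scal 0 = (0::'a::cstar_algebra)"
  by (simp add: cscale_def)

lemma scal_add: "scal (c + d) = scal c + (scal d :: 'a::cstar_algebra)"
  by (simp add: cscale_def algebra_simps)

lemma scal_mult: "scal (c * d) = scal c * (scal d :: 'a::cstar_algebra)"
  by (simp add: cscale_def algebra_simps ci_sq)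

lemma scal_sum: "scal (sum f A) = (\<Sum>i\<in>A. scal (f i) :: 'a::cstar_algebra)"
  by (induction A rule: infinite_finite_induct) (auto simp: scal_add)

lemma adj_scal: "cstar_adj (scal c) = (scal (cnj c) :: 'a::cstar_algebra)"
  by (simp add: cscale_def adj_simps adj_ci)

text \<open>The class provides only real homogeneity of the norm. The complex case follows from the
  C*-identity, because \<open>scal c\<close> is central with adjoint
  \<open>scal (cnj c)\<close>.\<close>

lemma norm_scal_mult [simp]: "norm (scal c * x) = cmod c * norm (x::'a::cstar_algebra)"
proof -
  have "cstar_adj (scal c * x) * (scal c * x) = cstar_adj x * ((scal (cnj c) * scal c) * x)"
    by (simp add: adj_simps adj_scal mult.assoc)
  also have "scal (cnj c) * scal c = ((cmod c)\<^sup>2) *\<^sub>R (1::'a)"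
    by (metis complex_norm_square mult.commute scal_mult scal_of_real)
  finally have "(norm (scal c * x))\<^sup>2 = (cmod c * norm x)\<^sup>2"
    using cstar_identity[of "scal c * x"] cstar_identity[of x] by (simp add: power_mult_distrib)
  then show ?thesis by (simp add: power2_eq_iff_nonneg)
qed

lemma cinv_unique:
  assumes "a * b = (1::'a::cstar_algebra)" "b * a = 1"
  shows "cinv a = b"
  unfolding cinv_def
proof (rule the_equality)
  fix c assume "a * c = 1 \<and> c * a = 1"
  then show "c = b" by (metis assms(2) mult.assoc mult.left_neutral mult.right_neutral)
qed (use assms in auto)

lemma cinv:
  assumes "cinvertible (a::'a::cstar_algebra)"
  shows "a * cinv a = 1" "cinv a * a = 1"
  using assms cinv_unique unfolding cinvertible_def by metis+

lemma cinvertibleI: "a * b = 1 \<Longrightarrow> c * a = 1 \<Longrightarrow> cinvertible (a::'a::cstar_algebra)"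
  unfolding cinvertible_def by (metis mult.assoc mult.left_neutral mult.right_neutral)

lemma cinvertible_scaleR:
  assumes "cinvertible (a::'a::cstar_algebra)" "r \<noteq> 0"
  shows "cinvertible (r *\<^sub>R a)"
  by (rule cinvertibleI[of _ "(1/r) *\<^sub>R cinv a" "(1/r) *\<^sub>R cinv a"]) (use assms cinv in auto)

lemma cinv_self_adj:
  assumes "cinvertible (a::'a::cstar_algebra)" "self_adj a"
  shows "self_adj (cinv a)"
  using cinv_unique[of a "cstar_adj (cinv a)"] cinv[OF assms(1)] assms(2)
  by (metis adj_mult adj_one)

section \<open>Geometric series and inverses\<close>

lemma geometric_partial_sum:
  fixes x :: "'a::ring_1"
  shows "(1 - x) * (\<Sum>i<n. x ^ i) = 1 - x ^ n" "(\<Sum>i<n. x ^ i) * (1 - x) = 1 - x ^ n"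
proof -
  show *: "(1 - x) * (\<Sum>i<n. x ^ i) = 1 - x ^ n"
    by (induction n) (simp_all add: distrib_left left_diff_distrib)
  have "(\<Sum>i<n. x ^ i) * (1 - x) = (1 - x) * (\<Sum>i<n. x ^ i)"
    by (simp add: left_diff_distrib right_diff_distrib sum_distrib_left sum_distrib_right power_commutes
        sum_subtractf)
  with * show "(\<Sum>i<n. x ^ i) * (1 - x) = 1 - x ^ n" by simp
qed

text \<open>The bound on \<open>norm g\<close> later controls the tail of the truncated series in
  \<open>poisson_partition\<close>.\<close>

lemma neumann_bound:
  fixes x :: "'a::cstar_algebra"
  assumes "norm x < 1"
  shows "\<exists>g. g * (1 - x) = 1 \<and> (1 - x) * g = 1 \<and> norm g \<le> 1 / (1 - norm x)"
proof -
  have s: "summable (\<lambda>n. x ^ n)" by (rule complete_algebra_summable_geometric[OF assms])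
  define g where "g = (\<Sum>n. x ^ n)"
  have l: "(\<lambda>n. x ^ n) \<longlonglongrightarrow> 0" using summable_LIMSEQ_zero[OF s] .
  have lim: "(\<lambda>n. \<Sum>i<n. x ^ i) \<longlonglongrightarrow> g"
    unfolding g_def by (rule summable_LIMSEQ[OF s])
  have lim1: "(\<lambda>n. 1 - x ^ n) \<longlonglongrightarrow> 1" using tendsto_diff[OF tendsto_const[of 1] l] by simp
  have "(\<lambda>n. (\<Sum>i<n. x ^ i) * (1 - x)) \<longlonglongrightarrow> g * (1 - x)"
    "(\<lambda>n. (1 - x) * (\<Sum>i<n. x ^ i)) \<longlonglongrightarrow> (1 - x) * g"
    by (intro tendsto_intros lim)+
  then have e: "g * (1 - x) = 1" "(1 - x) * g = 1"
    unfolding geometric_partial_sum using lim1 LIMSEQ_unique by blast+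
  have "norm g \<le> (\<Sum>n. norm x ^ n)"
    unfolding g_def
    by (rule norm_suminf_le) (use assms in \<open>auto intro: summable_geometric norm_power_ineq\<close>)
  also have "\<dots> = 1 / (1 - norm x)" using assms by (simp add: suminf_geometric)
  finally show ?thesis using e by blast
qed

lemma cinvertible_near_scalar:
  fixes x :: "'a::cstar_algebra"
  assumes "norm (t *\<^sub>R 1 - x) < t"
  shows "cinvertible x"
proof -
  have t: "t > 0" using assms norm_ge_zero[of "t *\<^sub>R 1 - x"] by linarith
  define y where "y = (1/t) *\<^sub>R (t *\<^sub>R 1 - x)"
  have "norm y < 1" using assms t by (simp add: y_def)
  then have "cinvertible (1 - y)" using neumann_bound cinvertibleI by blast
  then have "cinvertible (t *\<^sub>R (1 - y))" using t by (simp add: cinvertible_scaleR)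
  also have "t *\<^sub>R (1 - y) = x" using t by (simp add: y_def algebra_simps)
  finally show ?thesis .
qed

section \<open>Square roots and norm positivity\<close>

text \<open>The iteration \<open>b \<mapsto> (a + b\<^sup>2) / 2\<close> solves \<open>(1 - b)\<^sup>2 = 1 - a\<close>. Its increments are dominated by those
of the scalar iteration with \<open>a = 1\<close>, which makes it converge even when \<open>\<parallel>a\<parallel> = 1\<close>.\<close>

primrec sqrt_iter :: "'a::real_normed_algebra_1 \<Rightarrow> nat \<Rightarrow> 'a" where
  "sqrt_iter a 0 = 0"
| "sqrt_iter a (Suc n) = (1/2) *\<^sub>R (a + sqrt_iter a n * sqrt_iter a n)"

lemma sqrt_iter_real: "0 \<le> sqrt_iter (1::real) n" "sqrt_iter (1::real) n \<le> 1"
proof -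
  have "0 \<le> sqrt_iter (1::real) n \<and> sqrt_iter (1::real) n \<le> 1"
    by (induction n) (auto intro: mult_le_one)
  then show "0 \<le> sqrt_iter (1::real) n" "sqrt_iter (1::real) n \<le> 1" by auto
qed

lemma norm_sqrt_iter:
  assumes "norm a \<le> 1"
  shows "norm (sqrt_iter a n) \<le> sqrt_iter 1 n"
proof (induction n)
  case (Suc n)
  have "norm (sqrt_iter a n * sqrt_iter a n) \<le> sqrt_iter 1 n * sqrt_iter 1 n"
    by (rule order_trans[OF norm_mult_ineq]) (intro mult_mono Suc; simp add: sqrt_iter_real)
  with assms have "norm (a + sqrt_iter a n * sqrt_iter a n) \<le> 1 + sqrt_iter 1 n * sqrt_iter 1 n"
    by (intro norm_triangle_mono)
  then show ?case by simp
qed simp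

lemma sqrt_iter_commute: "z * a = a * z \<Longrightarrow> z * sqrt_iter a n = sqrt_iter a n * z"
proof (induction n)
  case (Suc n)
  then have "z * (sqrt_iter a n * sqrt_iter a n) = sqrt_iter a n * sqrt_iter a n * z"
    by (metis mult.assoc)
  with Suc show ?case by (simp add: algebra_simps)
qed simp

text \<open>The iterates commute, so the difference of two consecutive squares factors; each factor
  is dominated by its scalar counterpart.\<close>

lemma norm_sqrt_iter_increment:
  assumes "norm a \<le> 1"
  shows "norm (sqrt_iter a (Suc n) - sqrt_iter a n) \<le> sqrt_iter 1 (Suc n) - sqrt_iter 1 n"
proof (induction n)
  case 0
  then show ?case using assms by simp
next
  case (Suc n)
  let ?b = "sqrt_iter a" and ?c = "sqrt_iter (1::real)"
  have com: "?b n * ?b (Suc n) = ?b (Suc n) * ?b n"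
    by (intro sqrt_iter_commute sqrt_iter_commute[symmetric]) simp
  have "?b (Suc (Suc n)) - ?b (Suc n) = (1/2) *\<^sub>R (?b (Suc n) * ?b (Suc n) - ?b n * ?b n)"
    unfolding sqrt_iter.simps(2)[of a "Suc n"] sqrt_iter.simps(2)[of a n, folded One_nat_def]
    by (simp add: algebra_simps)
  also have "?b (Suc n) * ?b (Suc n) - ?b n * ?b n = (?b (Suc n) - ?b n) * (?b (Suc n) + ?b n)"
    using com by (simp add: algebra_simps del: sqrt_iter.simps)
  finally have eq: "?b (Suc (Suc n)) - ?b (Suc n)
      = (1/2) *\<^sub>R ((?b (Suc n) - ?b n) * (?b (Suc n) + ?b n))" .
  have "norm (?b (Suc (Suc n)) - ?b (Suc n))
      \<le> 1/2 * (norm (?b (Suc n) - ?b n) * norm (?b (Suc n) + ?b n))"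
    unfolding eq using norm_mult_ineq[of "?b (Suc n) - ?b n" "?b (Suc n) + ?b n"]
    by (simp del: sqrt_iter.simps)
  also have "\<dots> \<le> 1/2 * ((?c (Suc n) - ?c n) * (?c (Suc n) + ?c n))"
    by (intro mult_left_mono mult_mono Suc norm_triangle_mono norm_sqrt_iter assms)
      (use order_trans[OF norm_ge_zero Suc] in \<open>simp_all del: sqrt_iter.simps\<close>)
  also have "\<dots> = ?c (Suc (Suc n)) - ?c (Suc n)"
    by (simp add: algebra_simps)
  finally show ?case .
qed

text \<open>The bound on \<open>1 - k\<close> makes the root itself norm-positive; the commutation
  clause stands in for the functional calculus of \<open>a\<close>.\<close>

lemma sqrt_one_minus:
  fixes a :: "'a::cstar_algebra"
  assumes a: "self_adj a" and n: "norm a \<le> 1"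
  shows "\<exists>k. self_adj k \<and> k * k = 1 - a \<and> norm (1 - k) \<le> 1 \<and> (\<forall>z. z * a = a * z \<longrightarrow> z * k = k * z)"
proof -
  let ?b = "sqrt_iter a" and ?c = "sqrt_iter (1::real)"
  \<comment> \<open>For \<open>a = 1\<close> the increment estimate bounds a norm by the scalar
    increment, which is therefore nonnegative.\<close>
  have mono: "?c n \<le> ?c (Suc n)" for n
    using norm_sqrt_iter_increment[of "1::real" n] norm_ge_zero[of "?c (Suc n) - ?c n"] by simp
  have "convergent ?c"
    using mono sqrt_iter_real(2) incseq_convergent[of ?c 1] incseq_SucI[of ?c]
    unfolding convergent_def by blast
  then have "summable (\<lambda>n. ?c (Suc n) - ?c n)"
    unfolding convergent_def using telescope_summable by blast
  then have "summable (\<lambda>n. ?b (Suc n) - ?b n)"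
    by (rule summable_comparison_test[rotated]) (use norm_sqrt_iter_increment[OF n] in blast)
  then have "(\<lambda>n. \<Sum>i<n. ?b (Suc i) - ?b i) \<longlonglongrightarrow> (\<Sum>i. ?b (Suc i) - ?b i)"
    by (rule summable_LIMSEQ)
  then obtain b where b: "?b \<longlonglongrightarrow> b"
    unfolding sum_lessThan_telescope by (auto simp del: sqrt_iter.simps(2))
  have "(\<lambda>n. ?b (Suc n)) \<longlonglongrightarrow> (1/2) *\<^sub>R (a + b * b)"
    unfolding sqrt_iter.simps by (intro tendsto_intros b)
  with b have eq: "b = (1/2) *\<^sub>R (a + b * b)"
    using LIMSEQ_Suc LIMSEQ_unique by blast
  have "(2::real) *\<^sub>R b = a + b * b"
    by (subst eq) simp
  then have bb: "b * b = b + b - a" by (simp add: scaleR_2 algebra_simps)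
  have sab: "cstar_adj (?b n) = ?b n" for n
    by (induction n) (auto simp: adj_simps a)
  have "(\<lambda>n. cstar_adj (?b n)) \<longlonglongrightarrow> cstar_adj b"
    by (rule bounded_linear.tendsto[OF bounded_linear_adj b])
  then have sa: "self_adj b" using sab b LIMSEQ_unique by auto
  have nb: "norm b \<le> 1"
    by (rule LIMSEQ_le_const2[OF tendsto_norm[OF b]])
      (use norm_sqrt_iter[OF n] sqrt_iter_real order_trans in blast)
  have com: "z * b = b * z" if "z * a = a * z" for z
  proof -
    have "(\<lambda>n. z * ?b n) \<longlonglongrightarrow> z * b" "(\<lambda>n. ?b n * z) \<longlonglongrightarrow> b * z"
      by (intro tendsto_intros b)+
    then show ?thesis using sqrt_iter_commute[OF that] LIMSEQ_unique by auto
  qed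
  have "(1 - b) * (1 - b) = 1 - a"
    by (simp add: left_diff_distrib right_diff_distrib bb)
  moreover have "z * (1 - b) = (1 - b) * z" if "z * a = a * z" for z
    by (simp add: left_diff_distrib right_diff_distrib com[OF that])
  moreover have "self_adj (1 - b)" "norm (1 - (1 - b)) \<le> 1"
    using sa nb by (simp_all add: adj_diff)
  ultimately show ?thesis by blast
qed

section \<open>Norm positivity\<close>

definition norm_pos :: "'a::cstar_algebra \<Rightarrow> bool" where
  "norm_pos a \<longleftrightarrow> self_adj a \<and> (\<exists>t. norm (t *\<^sub>R 1 - a) \<le> t)"

lemma norm_pos_self_adj: "norm_pos a \<Longrightarrow> self_adj a"
  by (simp add: norm_pos_def)

lemma norm_pos_sqrt:
  fixes a :: "'a::cstar_algebra"
  assumes "norm_pos a"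
  shows "\<exists>h. norm_pos h \<and> h * h = a \<and> (\<forall>z. z * a = a * z \<longrightarrow> z * h = h * z)"
proof -
  from assms obtain t0 where sa: "self_adj a" and t0: "norm (t0 *\<^sub>R 1 - a) \<le> t0"
    by (auto simp: norm_pos_def)
  \<comment> \<open>The added 1 makes \<open>t\<close> positive, so that division by it is possible
    even when \<open>t0 = 0\<close>.\<close>
  define t where "t = t0 + 1"
  have tpos: "t > 0" using t0 norm_ge_zero[of "t0 *\<^sub>R 1 - a"] unfolding t_def by linarith
  have t: "norm (t *\<^sub>R 1 - a) \<le> t"
    using norm_triangle_ineq[of "t0 *\<^sub>R 1 - a" 1] t0 by (simp add: t_def algebra_simps)
  define b where "b = (1/t) *\<^sub>R (t *\<^sub>R 1 - a)"
  have "self_adj b" "norm b \<le> 1"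
    using tpos t sa by (auto simp: b_def adj_simps)
  from sqrt_one_minus[OF this] obtain k where k: "self_adj k" "k * k = 1 - b" "norm (1 - k) \<le> 1"
    and com: "\<And>z. z * b = b * z \<Longrightarrow> z * k = k * z" by blast
  let ?h = "sqrt t *\<^sub>R k"
  have "norm (sqrt t *\<^sub>R 1 - ?h) \<le> sqrt t"
    using k(3) tpos by (simp flip: scaleR_diff_right)
  then have "norm_pos ?h" using k(1) by (auto simp: norm_pos_def adj_simps)
  moreover have "?h * ?h = a"
    using tpos by (simp add: k(2) b_def scaleR_diff_right)
  moreover have "z * ?h = ?h * z" if "z * a = a * z" for z
  proof -
    have "z * b = b * z" using that by (simp add: b_def algebra_simps)
    then show ?thesis using com by simp
  qed
  ultimately show ?thesis by blast
qed

lemma scal_left_commute: "x * (scal c * y) = scal c * (x * (y::'a::cstar_algebra))"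
  by (metis mult.assoc scal_central)

lemma scal_ii_sq: "scal \<i> * (scal \<i> * x) = - (x::'a::cstar_algebra)"
proof -
  have "scal (\<i> * \<i>) = (- 1 :: 'a)" by (simp add: cscale_def)
  then show ?thesis by (metis mult.assoc mult_minus1 scal_mult)
qed

text \<open>The element \<open>y + i k\<close> is a multiple of a unitary with real part \<open>y\<close> and imaginary part \<open>k\<close>.\<close>

lemma norm_le_of_sum_squares:
  fixes y k :: "'a::cstar_algebra"
  assumes y: "self_adj y" and k: "self_adj k" and com: "y * k = k * y"
    and sum: "y * y + k * k = (T\<^sup>2) *\<^sub>R 1" and T: "T \<ge> 0"
  shows "norm y \<le> T" "norm k \<le> T"
proof -
  define u where "u = y + scal \<i> * k"
  have adj: "cstar_adj u = y - scal \<i> * k"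
  proof -
    have "scal (- \<i>) = - (scal \<i> :: 'a)" by (simp add: cscale_def)
    then show ?thesis by (simp add: u_def adj_simps y k adj_scal scal_central)
  qed
  have "cstar_adj u * u = y * y - scal \<i> * (scal \<i> * (k * k))"
    unfolding adj unfolding u_def
    by (simp add: left_diff_distrib distrib_left mult.assoc scal_left_commute[of y] scal_left_commute[of k] com)
  then have "cstar_adj u * u = (T\<^sup>2) *\<^sub>R 1" using sum by (simp add: scal_ii_sq)
  then have "(norm u)\<^sup>2 = T\<^sup>2" using cstar_identity[of u] by simp
  then have u: "norm u = T" using T by (simp add: power2_eq_iff_nonneg)
  have "2 *\<^sub>R y = u + cstar_adj u" unfolding adj by (simp add: u_def scaleR_2)
  then have "2 * norm y \<le> 2 * T" using norm_triangle_ineq[of u "cstar_adj u"] u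
    by (metis abs_numeral mult_2 norm_adj norm_scaleR)
  then show "norm y \<le> T" by simp
  have "2 *\<^sub>R (scal \<i> * k) = u - cstar_adj u" unfolding adj by (simp add: u_def scaleR_2)
  then have "norm (2 *\<^sub>R (scal \<i> * k)) \<le> 2 * T" using norm_triangle_ineq4[of u "cstar_adj u"] u
    by simp
  then show "norm k \<le> T" by simp
qed

text \<open>By \<open>sqrt_one_minus\<close>, t - h^2 is the square of some \<open>?k\<close>
  commuting with \<open>h\<close>. The squares of \<open>h\<close> and \<open>?k\<close> sum to t,
  so \<open>norm_le_of_sum_squares\<close> bounds \<open>?k\<close> by
  \<open>sqrt t\<close>.\<close>

lemma norm_diff_square_le:
  fixes h :: "'a::cstar_algebra"
  assumes h: "self_adj h" and t: "(norm h)\<^sup>2 \<le> t"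
  shows "norm (t *\<^sub>R 1 - h * h) \<le> t"
proof (cases "t = 0")
  case False
  then have tpos: "t > 0" using t zero_le_power2[of "norm h"] by linarith
  define a where "a = (1/t) *\<^sub>R (h * h)"
  have "self_adj a" "norm a \<le> 1"
    using h t tpos by (auto simp: a_def adj_simps norm_self_adj_square)
  from sqrt_one_minus[OF this] obtain k where k: "self_adj k" "k * k = 1 - a"
    and com: "\<And>z. z * a = a * z \<Longrightarrow> z * k = k * z" by blast
  have hk: "h * k = k * h" by (rule com) (simp add: a_def mult.assoc)
  let ?k = "sqrt t *\<^sub>R k"
  have kk: "?k * ?k = t *\<^sub>R 1 - h * h"
    using tpos by (simp add: k(2) a_def scaleR_diff_right)
  have "norm ?k \<le> sqrt t"
    by (rule norm_le_of_sum_squares(2)[of h]) (use h k hk kk tpos in \<open>auto simp: adj_simps\<close>)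
  then have "norm (?k * ?k) \<le> sqrt t * sqrt t"
    using tpos by (intro order_trans[OF norm_mult_ineq] mult_mono) auto
  then show ?thesis unfolding kk using tpos by simp
qed (use t in auto)

lemma norm_pos_square: "self_adj h \<Longrightarrow> norm_pos (h * h)"
  using norm_diff_square_le[of h] by (auto simp: norm_pos_def adj_simps)

lemma norm_pos_iff_square: "norm_pos a \<longleftrightarrow> (\<exists>h. self_adj h \<and> a = h * h)"
  using norm_pos_sqrt[of a] norm_pos_square norm_pos_self_adj by blast

text \<open>Fixing the witness at the norm turns the existential into a closed condition, as
  \<open>norm_pos_limit\<close> requires. Writing a = h^2, the choice t = |h|^2 = |a| works.\<close>

lemma norm_pos_iff_norm:
  "norm_pos a \<longleftrightarrow> self_adj a \<and> norm (norm a *\<^sub>R 1 - a) \<le> norm (a::'a::cstar_algebra)"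
proof
  assume "norm_pos a"
  then obtain h where "self_adj h" "a = h * h" by (auto simp: norm_pos_iff_square)
  then show "self_adj a \<and> norm (norm a *\<^sub>R 1 - a) \<le> norm a"
    using norm_diff_square_le[of h "norm a"] by (auto simp: norm_self_adj_square adj_simps)
qed (auto simp: norm_pos_def)

lemma norm_pos_add:
  assumes "norm_pos a" "norm_pos (b::'a::cstar_algebra)"
  shows "norm_pos (a + b)"
proof -
  from assms obtain t u where "norm (t *\<^sub>R 1 - a) \<le> t" "norm (u *\<^sub>R 1 - b) \<le> u"
    by (auto simp: norm_pos_def)
  then have "norm ((t + u) *\<^sub>R 1 - (a + b)) \<le> t + u"
    using norm_triangle_ineq[of "t *\<^sub>R 1 - a" "u *\<^sub>R 1 - b"] by (simp add: algebra_simps)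
  with assms show ?thesis by (auto simp: norm_pos_def adj_add)
qed

lemma norm_pos_scaleR:
  assumes "norm_pos (a::'a::cstar_algebra)" "r \<ge> 0"
  shows "norm_pos (r *\<^sub>R a)"
proof -
  from assms obtain t where "norm (t *\<^sub>R 1 - a) \<le> t" by (auto simp: norm_pos_def)
  then have "norm (r *\<^sub>R (t *\<^sub>R 1 - a)) \<le> r * t" using assms(2) by (simp add: mult_left_mono)
  then have "norm ((r * t) *\<^sub>R 1 - r *\<^sub>R a) \<le> r * t" by (simp add: algebra_simps)
  with assms show ?thesis by (auto simp: norm_pos_def adj_scaleR)
qed

lemma norm_pos_scaleR_one: "r \<ge> 0 \<Longrightarrow> norm_pos (r *\<^sub>R (1::'a::cstar_algebra))"
  by (simp add: norm_pos_def adj_scaleR exI[of _ r])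

lemma norm_pos_limit:
  fixes f :: "nat \<Rightarrow> 'a::cstar_algebra"
  assumes "\<And>n. norm_pos (f n)" and "f \<longlonglongrightarrow> a"
  shows "norm_pos a"
proof -
  have "(\<lambda>n. cstar_adj (f n)) \<longlonglongrightarrow> cstar_adj a"
    by (rule bounded_linear.tendsto[OF bounded_linear_adj assms(2)])
  then have "self_adj a"
    unfolding norm_pos_self_adj[OF assms(1)] using LIMSEQ_unique assms(2) by blast
  moreover have "norm (norm a *\<^sub>R 1 - a) \<le> norm a"
    by (rule LIMSEQ_le[of "\<lambda>n. norm (norm (f n) *\<^sub>R 1 - f n)" _ "\<lambda>n. norm (f n)"])
      (use assms in \<open>auto intro!: tendsto_intros simp: norm_pos_iff_norm\<close>)
  ultimately show ?thesis by (simp add: norm_pos_iff_norm)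
qed

text \<open>The commutation clause of \<open>norm_pos_sqrt\<close>, used twice, gives commuting
  roots \<open>h\<close> and \<open>k\<close>, and then a b = (h k)^2.\<close>

lemma norm_pos_mult:
  assumes "norm_pos (a::'a::cstar_algebra)" "norm_pos b" "a * b = b * a"
  shows "norm_pos (a * b)"
proof -
  obtain h where h: "norm_pos h" "h * h = a" "\<And>z. z * a = a * z \<Longrightarrow> z * h = h * z"
    using norm_pos_sqrt[OF assms(1)] by blast
  obtain k where k: "norm_pos k" "k * k = b" "\<And>z. z * b = b * z \<Longrightarrow> z * k = k * z"
    using norm_pos_sqrt[OF assms(2)] by blast
  have "b * h = h * b" using h(3) assms(3) by simp
  then have hk: "h * k = k * h" using k(3) by simp
  have "a * b = (h * k) * (h * k)" by (metis h(2) hk k(2) mult.assoc)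
  moreover have "self_adj (h * k)"
    using h(1) k(1) hk by (simp add: adj_simps norm_pos_self_adj)
  ultimately show ?thesis by (auto simp: norm_pos_iff_square)
qed

text \<open>The commuting factors T - z and T + z have product T^2 - z^2 = q^2, so z^2 + q^2 = T^2
  and \<open>norm_le_of_sum_squares\<close> applies.\<close>

lemma norm_le_of_norm_pos:
  fixes z :: "'a::cstar_algebra"
  assumes "norm_pos (T *\<^sub>R 1 - z)" "norm_pos (T *\<^sub>R 1 + z)"
  shows "norm z \<le> T"
proof -
  have z: "self_adj z" using norm_pos_self_adj[OF assms(1)] by (simp add: adj_simps)
  have 2: "norm_pos ((2 * T) *\<^sub>R (1::'a))"
    using norm_pos_add[OF assms] by (simp flip: scaleR_add_left)
  \<comment> \<open>For negative \<open>T\<close> the norm criterion would read 4|T| <=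
    2|T|.\<close>
  have T: "T \<ge> 0"
    using 2[unfolded norm_pos_iff_norm] by (auto simp flip: scaleR_diff_left)
  have "norm_pos ((T *\<^sub>R 1 - z) * (T *\<^sub>R 1 + z))"
    by (rule norm_pos_mult[OF assms]) (simp add: algebra_simps)
  also have "(T *\<^sub>R 1 - z) * (T *\<^sub>R 1 + z) = (T\<^sup>2) *\<^sub>R 1 - z * z"
    by (simp add: algebra_simps power2_eq_square)
  finally obtain q where q: "norm_pos q" "q * q = (T\<^sup>2) *\<^sub>R 1 - z * z"
    "\<And>x. x * ((T\<^sup>2) *\<^sub>R 1 - z * z) = ((T\<^sup>2) *\<^sub>R 1 - z * z) * x \<Longrightarrow> x * q = q * x"
    using norm_pos_sqrt by metis
  have "z * q = q * z" by (rule q(3)) (simp add: algebra_simps)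
  then show ?thesis
    by (rule norm_le_of_sum_squares(1)[OF z norm_pos_self_adj[OF q(1)] _ _ T]) (simp add: q(2))
qed

lemma cinvertible_norm_pos_add:
  fixes p :: "'a::cstar_algebra"
  assumes "norm_pos p" "e > 0"
  shows "cinvertible (p + e *\<^sub>R 1)"
proof -
  obtain t where "norm (t *\<^sub>R 1 - p) \<le> t" using assms(1) by (auto simp: norm_pos_def)
  then have "norm ((t + e) *\<^sub>R 1 - (p + e *\<^sub>R 1)) < t + e"
    using assms(2) by (simp add: algebra_simps)
  then show ?thesis by (rule cinvertible_near_scalar)
qed

text \<open>If \<open>h\<^sup>2\<close> is invertible with inverse \<open>q\<close> and \<open>k\<^sup>2 = 1 - d q\<close>, then \<open>h\<^sup>2 - d = (h k)\<^sup>2\<close>. Hence positivity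
of \<open>x + e\<close> persists while \<open>e\<close> decreases through values for which \<open>x + e\<close> is invertible.\<close>

lemma norm_pos_of_cinvertible_shifts:
  fixes x :: "'a::cstar_algebra"
  assumes sa: "self_adj x" and inv: "\<And>e. e > 0 \<Longrightarrow> cinvertible (x + e *\<^sub>R 1)"
  shows "norm_pos x"
proof -
  define E where "E = {e. e \<ge> 0 \<and> norm_pos (x + e *\<^sub>R 1)}"
  have bdd: "bdd_below E" by (auto simp: E_def bdd_below_def)
  have "norm x \<in> E" using sa
    by (auto simp: E_def norm_pos_def adj_simps intro!: exI[of _ "norm x"])
  then have ne: "E \<noteq> {}" by blast
  have "closed E"
    unfolding closed_sequential_limits
  proof (intro allI impI)
    fix f l assume fl: "(\<forall>n. f n \<in> E) \<and> f \<longlonglongrightarrow> l"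
    have "norm_pos (x + l *\<^sub>R 1)"
      by (rule norm_pos_limit[of "\<lambda>n. x + f n *\<^sub>R 1"])
        (use fl in \<open>auto simp: E_def intro!: tendsto_intros\<close>)
    moreover have "l \<ge> 0"
      by (rule LIMSEQ_le_const[of f]) (use fl in \<open>auto simp: E_def\<close>)
    ultimately show "l \<in> E" by (simp add: E_def)
  qed
  then have mem: "Inf E \<in> E" using closed_contains_Inf[OF ne bdd] by blast
  have "Inf E = 0"
  proof (rule ccontr)
    assume "Inf E \<noteq> 0"
    then have pos: "Inf E > 0" using mem by (simp add: E_def)
    define a where "a = x + Inf E *\<^sub>R 1"
    have ia: "cinvertible a" using inv[OF pos] by (simp add: a_def)
    have a: "norm_pos a" using mem by (simp add: E_def a_def)
    obtain h where h: "norm_pos h" "h * h = a" "\<And>z. z * a = a * z \<Longrightarrow> z * h = h * z"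
      using norm_pos_sqrt[OF a] by blast
    define q where "q = cinv a"
    have q: "a * q = 1" "q * a = 1" "self_adj q"
      using cinv[OF ia] cinv_self_adj[OF ia norm_pos_self_adj[OF a]] by (auto simp: q_def)
    \<comment> \<open>The first bound keeps the new shift nonnegative; the second gives
      \<open>d *\<^sub>R q\<close> norm at most 1, so that 1 - d q has a root.\<close>
    define d where "d = min (Inf E) (1 / (norm q + 1))"
    have d: "d > 0" "d \<le> Inf E"
      using pos by (auto simp: d_def add_nonneg_pos)
    have "d * norm q \<le> 1 / (norm q + 1) * norm q" by (intro mult_right_mono) (auto simp: d_def)
    also have "\<dots> \<le> 1" by (simp add: add_nonneg_pos)
    finally have "norm (d *\<^sub>R q) \<le> 1" using d by simp
    moreover have "self_adj (d *\<^sub>R q)" using q(3) by (simp add: adj_simps)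
    ultimately obtain k where k: "self_adj k" "k * k = 1 - d *\<^sub>R q"
      and kc: "\<And>z. z * (d *\<^sub>R q) = d *\<^sub>R q * z \<Longrightarrow> z * k = k * z"
      using sqrt_one_minus[of "d *\<^sub>R q"] by blast
    have "q * h = h * q" by (rule h(3)) (simp add: q)
    then have hk: "h * k = k * h" by (intro kc) simp
    have "(h * k) * (h * k) = a * (1 - d *\<^sub>R q)" by (metis h(2) hk k(2) mult.assoc)
    also have "\<dots> = x + (Inf E - d) *\<^sub>R 1" using q by (simp add: a_def algebra_simps)
    finally have "norm_pos (x + (Inf E - d) *\<^sub>R 1)"
      using norm_pos_square[of "h * k"] h(1) k(1) hk by (simp add: adj_simps norm_pos_self_adj)
    then have "Inf E - d \<in> E" using d by (simp add: E_def)
    then have "Inf E \<le> Inf E - d" using bdd by (simp add: cInf_lower)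
    then show False using d by simp
  qed
  then show ?thesis using mem by (simp add: E_def)
qed

text \<open>Forwards, the spectrum contains no negative reals, so all positive shifts are
  invertible. Backwards, a non-real c is excluded because x - c is a multiple of y - i with y
  self-adjoint, and (y - i)(y + i) = y^2 + 1 is invertible; a negative real c is excluded by
  invertibility of the shift.\<close>

lemma positive_iff_norm_pos: "positive x \<longleftrightarrow> norm_pos (x::'a::cstar_algebra)"
proof
  assume x: "positive x"
  show "norm_pos x"
  proof (rule norm_pos_of_cinvertible_shifts)
    show "self_adj x" using x by (simp add: positive_def)
    fix e :: real assume "e > 0"
    then have "complex_of_real (- e) \<notin> elem_spectrum x" using x by (auto simp: positive_def)
    then have "cinvertible (x - scal (complex_of_real (- e)))" by (simp add: elem_spectrum_def)
    then show "cinvertible (x + e *\<^sub>R 1)" unfolding scal_of_real by simp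
  qed
next
  assume p: "norm_pos x"
  have sa: "self_adj x" by (rule norm_pos_self_adj[OF p])
  have "Im c = 0 \<and> 0 \<le> Re c" if c: "\<not> cinvertible (x - scal c)" for c
  proof -
    have im: "Im c = 0"
    proof (rule ccontr)
      assume nz: "Im c \<noteq> 0"
      define y where "y = (1 / Im c) *\<^sub>R (x - Re c *\<^sub>R 1)"
      have "self_adj y" using sa by (simp add: y_def adj_simps)
      then have "cinvertible (y * y + 1 *\<^sub>R 1)"
        by (intro cinvertible_norm_pos_add norm_pos_square) auto
      then obtain q where q: "(y * y + 1) * q = 1" "q * (y * y + 1) = 1"
        by (auto simp: cinvertible_def)
      have f: "(y - ci) * (y + ci) = y * y + 1" "(y + ci) * (y - ci) = y * y + 1"
        using ci_central[of y] ci_sq[where ?'a='a] by (simp_all add: algebra_simps)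
      have "cinvertible (y - ci)"
        by (rule cinvertibleI[of _ "(y + ci) * q" "q * (y + ci)"]) (metis f q mult.assoc)+
      then have "cinvertible (Im c *\<^sub>R (y - ci))" using nz by (rule cinvertible_scaleR)
      also have "Im c *\<^sub>R (y - ci) = x - scal c"
        using nz by (simp add: y_def cscale_def algebra_simps)
      finally show False using c by blast
    qed
    moreover have "0 \<le> Re c"
    proof (rule ccontr)
      assume "\<not> 0 \<le> Re c"
      then have "cinvertible (x + (- Re c) *\<^sub>R 1)" by (intro cinvertible_norm_pos_add p) simp
      then show False using c im by (simp add: cscale_def)
    qed
    ultimately show ?thesis by blast
  qed
  then show "positive x" using sa by (auto simp: positive_def elem_spectrum_def)
qed

section \<open>Positivity of products with adjoints\<close>

lemmas positive_add = norm_pos_add[folded positive_iff_norm_pos]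
  and positive_scaleR = norm_pos_scaleR[folded positive_iff_norm_pos]
  and positive_scaleR_one = norm_pos_scaleR_one[folded positive_iff_norm_pos]
  and positive_limit = norm_pos_limit[folded positive_iff_norm_pos]
  and positive_mult = norm_pos_mult[folded positive_iff_norm_pos]
  and positive_square = norm_pos_square[folded positive_iff_norm_pos]
  and positive_sqrt = norm_pos_sqrt[folded positive_iff_norm_pos]
  and positive_self_adj = norm_pos_self_adj[folded positive_iff_norm_pos]
  and norm_le_of_positive = norm_le_of_norm_pos[folded positive_iff_norm_pos]
  and positive_of_cinvertible_shifts = norm_pos_of_cinvertible_shifts[folded positive_iff_norm_pos]
  and cinvertible_positive_add = cinvertible_norm_pos_add[folded positive_iff_norm_pos]

lemma positive_zero: "positive (0::'a::cstar_algebra)"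
  using positive_scaleR_one[of 0] by simp

lemma positive_sum: "(\<And>i. i \<in> A \<Longrightarrow> positive (f i)) \<Longrightarrow> positive (\<Sum>i\<in>A. f i :: 'a::cstar_algebra)"
  by (induction A rule: infinite_finite_induct) (auto intro: positive_zero positive_add)

lemma positive_shift_of_norm_le:
  assumes "self_adj (x::'a::cstar_algebra)" "norm x \<le> t"
  shows "positive (t *\<^sub>R 1 - x)" "positive (t *\<^sub>R 1 + x)"
  using assms by (auto simp: positive_iff_norm_pos norm_pos_def adj_simps intro!: exI[of _ t])

text \<open>Otherwise 1 would lie between 0 and 0 in the order and have norm 0. This produces the
  contradiction in \<open>op_spectrum_nonempty\<close>.\<close>

lemma not_positive_minus_one: "\<not> positive (- 1 :: 'a::cstar_algebra)"
proof
  assume "positive (- 1 :: 'a)"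
  then have "norm (1::'a) \<le> 0"
    using positive_scaleR_one[of 1] by (intro norm_le_of_positive) auto
  then show False by simp
qed

text \<open>If g inverts 1 + x y, then 1 - y g x inverts 1 + y x.\<close>

lemma cinvertible_one_plus_swap:
  assumes "cinvertible (1 + x * (y::'a::cstar_algebra))"
  shows "cinvertible (1 + y * x)"
proof -
  define g where "g = cinv (1 + x * y)"
  have "(1 + x * y) * g = 1" "g * (1 + x * y) = 1" using cinv[OF assms] by (auto simp: g_def)
  then have g: "x * (y * g) = 1 - g" "g * (x * y) = 1 - g"
    by (simp_all add: algebra_simps)
  have "y * (x * (y * (g * x))) = y * ((x * (y * g)) * x)" by (simp add: mult.assoc)
  also have "\<dots> = y * x - y * (g * x)" unfolding g by (simp add: algebra_simps)
  finally have 1: "(1 + y * x) * (1 - y * g * x) = 1" by (simp add: algebra_simps)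
  have "y * (g * (x * (y * x))) = y * ((g * (x * y)) * x)" by (simp add: mult.assoc)
  also have "\<dots> = y * x - y * (g * x)" unfolding g by (simp add: algebra_simps)
  finally have 2: "(1 - y * g * x) * (1 + y * x) = 1" by (simp add: algebra_simps)
  show ?thesis using cinvertibleI[OF 1 2] .
qed

text \<open>After division by e > 0, the invertibility of e - c* c passes to e - c c* by
  \<open>cinvertible_one_plus_swap\<close>; invertibility of all these shifts gives
  positivity.\<close>

lemma positive_minus_adj_swap:
  assumes "positive (- (cstar_adj c * (c::'a::cstar_algebra)))"
  shows "positive (- (c * cstar_adj c))"
proof (rule positive_of_cinvertible_shifts)
  fix e :: real assume e: "e > 0"
  have "cinvertible ((1/e) *\<^sub>R (- (cstar_adj c * c) + e *\<^sub>R 1))"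
    using e by (intro cinvertible_scaleR cinvertible_positive_add assms) auto
  also have "(1/e) *\<^sub>R (- (cstar_adj c * c) + e *\<^sub>R 1) = 1 + ((- 1/e) *\<^sub>R cstar_adj c) * c"
    using e by (simp add: scaleR_add_right scaleR_diff_right)
  finally have "cinvertible (1 + c * ((- 1/e) *\<^sub>R cstar_adj c))"
    by (rule cinvertible_one_plus_swap)
  then have "cinvertible (e *\<^sub>R (1 + c * ((- 1/e) *\<^sub>R cstar_adj c)))"
    using e by (intro cinvertible_scaleR) auto
  then show "cinvertible (- (c * cstar_adj c) + e *\<^sub>R 1)"
    using e by (simp add: scaleR_add_right scaleR_diff_right)
qed (simp add: adj_simps)

text \<open>Up to sign, \<open>?x\<close> and \<open>?y\<close> are twice the real and imaginary
  parts of \<open>c\<close>, and half the sum of their squares is the element in question.\<close>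

lemma positive_adj_mult_sum: "positive (cstar_adj c * c + c * cstar_adj (c::'a::cstar_algebra))"
proof -
  let ?x = "c + cstar_adj c" and ?y = "ci * (c - cstar_adj c)"
  have y: "self_adj ?y" by (simp add: adj_simps adj_ci ci_central algebra_simps)
  have "?y * ?y = ci * ci * ((c - cstar_adj c) * (c - cstar_adj c))"
    by (metis ci_central mult.assoc)
  then have yy: "?y * ?y = - ((c - cstar_adj c) * (c - cstar_adj c))" by (simp add: ci_sq)
  have "positive ((1/2) *\<^sub>R (?x * ?x + ?y * ?y))"
    by (intro positive_scaleR positive_add positive_square y) (auto simp: adj_simps algebra_simps)
  also have "?x * ?x + ?y * ?y = 2 *\<^sub>R (cstar_adj c * c + c * cstar_adj c)"
    unfolding yy by (simp add: algebra_simps scaleR_2)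
  finally show ?thesis by simp
qed

text \<open>With \<open>b = a\<^sup>* a\<close>, \<open>m = |b|\<close> and \<open>d = m - b\<close> (twice the negative part of \<open>b\<close>), the element \<open>c = a d\<close> satisfies
\<open>c\<^sup>* c = - m d\<^sup>2 \<le> 0\<close>, which forces \<open>c\<^sup>* c = 0\<close> and then \<open>d = 0\<close>.\<close>

theorem positive_adj_mult: "positive (cstar_adj a * (a::'a::cstar_algebra))"
proof -
  define b where "b = cstar_adj a * a"
  have b: "self_adj b" by (simp add: b_def adj_simps)
  obtain m where m: "positive m" "m * m = b * b"
    and mc: "\<And>z. z * (b * b) = b * b * z \<Longrightarrow> z * m = m * z"
    using positive_sqrt[OF positive_square[OF b]] by blast
  have bm: "b * m = m * b" by (rule mc) (simp add: mult.assoc)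
  define d where "d = m - b"
  have d: "self_adj d" using b positive_self_adj[OF m(1)] by (simp add: d_def adj_simps)
  have dm: "d * m = m * d" using bm by (simp add: d_def algebra_simps)
  have dd: "d * d = 2 *\<^sub>R (m * d)"
    using bm m(2) by (simp add: d_def algebra_simps scaleR_2)
  have ddd: "d * (d * d) = 2 *\<^sub>R (m * (d * d))"
    by (metis dd mult.assoc mult_scaleR_left)
  define c where "c = a * d"
  have "cstar_adj c * c = d * (b * d)"
    by (simp add: c_def adj_simps d b_def mult.assoc)
  also have "\<dots> = d * (m * d) - d * (d * d)"
    by (simp add: d_def algebra_simps)
  also have "\<dots> = - (m * (d * d))"
    unfolding ddd using dm by (simp add: scaleR_2 flip: mult.assoc)
  finally have cc: "cstar_adj c * c = - (m * (d * d))" .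
  have "m * (d * d) = d * d * m" using dm by (metis mult.assoc)
  then have "positive (m * (d * d))"
    by (intro positive_mult m positive_square d)
  then have neg: "positive (- (cstar_adj c * c))" by (simp add: cc)
  \<comment> \<open>Adding -c c* >= 0 to c* c + c c* >= 0 leaves c* c >= 0; together with
    \<open>neg\<close> this forces c* c = 0.\<close>
  have "positive ((cstar_adj c * c + c * cstar_adj c) + (- (c * cstar_adj c)))"
    by (intro positive_add positive_adj_mult_sum positive_minus_adj_swap neg)
  then have "norm (cstar_adj c * c) \<le> 0"
    using neg by (intro norm_le_of_positive) auto
  \<comment> \<open>From m d^2 = 0 follows d^3 = 2 m d^2 = 0, hence d^4 = 0, and the C*-identity
    applied twice gives d = 0.\<close>
  then have "d * (d * d) = 0" by (simp add: ddd cc)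
  then have "(d * d) * (d * d) = 0" by (simp add: mult.assoc)
  then have "norm (d * d) = 0"
    using norm_self_adj_square[of "d * d"] d by (simp add: adj_simps)
  then have "d = 0" using norm_self_adj_square[OF d] by simp
  then show ?thesis using m(1) by (simp add: d_def b_def)
qed

lemma positive_conj:
  assumes "positive (p::'a::cstar_algebra)"
  shows "positive (cstar_adj x * p * x)"
proof -
  obtain h where h: "positive h" "h * h = p" using positive_sqrt[OF assms] by blast
  have "cstar_adj x * p * x = cstar_adj (h * x) * (h * x)"
    by (simp add: adj_simps positive_self_adj[OF h(1)] mult.assoc flip: h(2))
  then show ?thesis using positive_adj_mult by metis
qed

section \<open>The Russo-Dye bound for positive maps\<close>

text \<open>Let z be the combination and P the sum of the p_k. Summing the positive elements (z - T
  w_k)* p_k (z - T w_k) gives z* P z - 2 T z* z + T^2 P >= 0. Inserting P <= T in both outer terms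
  leaves z* z <= T^2.\<close>

lemma norm_unimodular_combination_le:
  fixes p :: "'i \<Rightarrow> 'a::cstar_algebra"
  assumes p: "\<And>k. k \<in> A \<Longrightarrow> positive (p k)" and w: "\<And>k. k \<in> A \<Longrightarrow> cmod (w k) = 1"
    and T: "T > 0" "positive (T *\<^sub>R 1 - (\<Sum>k\<in>A. p k))"
  shows "norm (\<Sum>k\<in>A. scal (w k) * p k) \<le> T"
proof -
  define z where "z = (\<Sum>k\<in>A. scal (w k) * p k)"
  define P where "P = (\<Sum>k\<in>A. p k)"
  have zs: "cstar_adj z = (\<Sum>k\<in>A. scal (cnj (w k)) * p k)"
    unfolding z_def adj_sum
    by (intro sum.cong) (auto simp: adj_simps adj_scal scal_central positive_self_adj[OF p])
  have conj_term: "cstar_adj (z - T *\<^sub>R scal (w k)) * p k * (z - T *\<^sub>R scal (w k))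
     = cstar_adj z * p k * z - T *\<^sub>R (cstar_adj z * (scal (w k) * p k))
       - T *\<^sub>R (scal (cnj (w k)) * p k * z) + (T * T) *\<^sub>R p k" if k: "k \<in> A" for k
  proof -
    have "scal (cnj (w k)) * (scal (w k) * p k) = p k"
    proof -
      have "cnj (w k) * w k = 1" using w[OF k] by (metis complex_norm_square mult.commute of_real_1 power_one)
      then show ?thesis by (metis mult.assoc mult.left_neutral scal_mult scal_one)
    qed
    then show ?thesis
      by (simp add: adj_simps adj_scal left_diff_distrib right_diff_distrib mult.assoc
          scal_central[of "p k"] scaleR_diff_right)
  qed
  have "positive (\<Sum>k\<in>A. cstar_adj (z - T *\<^sub>R scal (w k)) * p k * (z - T *\<^sub>R scal (w k)))"
    by (intro positive_sum positive_conj p)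
  also have "(\<Sum>k\<in>A. cstar_adj (z - T *\<^sub>R scal (w k)) * p k * (z - T *\<^sub>R scal (w k)))
     = cstar_adj z * P * z - T *\<^sub>R (cstar_adj z * z) - T *\<^sub>R (cstar_adj z * z) + (T * T) *\<^sub>R P"
  proof -
    have "(\<Sum>k\<in>A. cstar_adj (z - T *\<^sub>R scal (w k)) * p k * (z - T *\<^sub>R scal (w k)))
      = (\<Sum>k\<in>A. cstar_adj z * p k * z - T *\<^sub>R (cstar_adj z * (scal (w k) * p k))
       - T *\<^sub>R (scal (cnj (w k)) * p k * z) + (T * T) *\<^sub>R p k)"
      by (intro sum.cong conj_term refl)
    also have "\<dots> = cstar_adj z * P * z - T *\<^sub>R (cstar_adj z * (\<Sum>k\<in>A. scal (w k) * p k))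
       - T *\<^sub>R ((\<Sum>k\<in>A. scal (cnj (w k)) * p k) * z) + (T * T) *\<^sub>R P"
      unfolding P_def
      by (simp only: sum.distrib sum_subtractf sum_distrib_left sum_distrib_right scaleR_sum_right)
    finally show ?thesis unfolding z_def[symmetric] zs[symmetric] .
  qed
  finally have 1: "positive \<dots>" .
  have 2: "positive (cstar_adj z * (T *\<^sub>R 1 - P) * z)"
    by (intro positive_conj T(2)[folded P_def])
  have "positive ((1/T) *\<^sub>R (cstar_adj z * P * z - T *\<^sub>R (cstar_adj z * z) - T *\<^sub>R (cstar_adj z * z)
     + (T * T) *\<^sub>R P + cstar_adj z * (T *\<^sub>R 1 - P) * z) + T *\<^sub>R (T *\<^sub>R 1 - P))"
    by (intro positive_add positive_scaleR 1 2 T(2)[folded P_def]) (use T in auto)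
  also have "(1/T) *\<^sub>R (cstar_adj z * P * z - T *\<^sub>R (cstar_adj z * z) - T *\<^sub>R (cstar_adj z * z)
     + (T * T) *\<^sub>R P + cstar_adj z * (T *\<^sub>R 1 - P) * z) + T *\<^sub>R (T *\<^sub>R 1 - P)
     = (T * T) *\<^sub>R 1 - cstar_adj z * z"
    using T(1) by (simp add: left_diff_distrib right_diff_distrib scaleR_diff_right scaleR_add_right)
  finally have "positive ((T * T) *\<^sub>R 1 - cstar_adj z * z)" .
  moreover have "positive ((T * T) *\<^sub>R 1 + cstar_adj z * z)"
    by (intro positive_add positive_adj_mult positive_scaleR_one) simp
  ultimately have "(norm z)\<^sup>2 \<le> T\<^sup>2"
    using norm_le_of_positive[of "T * T" "cstar_adj z * z"]
    by (simp add: cstar_identity power2_eq_square[of T])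
  then have "norm z \<le> T" by (rule power2_le_imp_le) (use T(1) in simp)
  then show ?thesis by (simp add: z_def)
qed

text \<open>The element equals g* (1 - b* b) g, the operator form of the Poisson kernel (1 - |z|^2)
  / |1 - z|^2.\<close>

lemma positive_poisson_kernel:
  assumes "(1 - b) * g = (1::'a::cstar_algebra)" "norm b \<le> 1"
  shows "positive (g + cstar_adj g - 1)"
proof -
  have bg: "b * g = g - 1" using assms(1) by (simp add: algebra_simps)
  have "cstar_adj ((1 - b) * g) = 1" using assms(1) by simp
  then have gb: "cstar_adj g * cstar_adj b = cstar_adj g - 1"
    by (simp add: adj_simps algebra_simps)
  have "norm (cstar_adj b * b) \<le> 1" using assms(2) by (simp add: cstar_identity power_le_one)
  then have "positive (1 *\<^sub>R 1 - cstar_adj b * b)"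
    by (intro positive_shift_of_norm_le) (simp_all add: adj_simps)
  then have "positive (cstar_adj g * (1 - cstar_adj b * b) * g)"
    using positive_conj by simp
  also have "cstar_adj g * (1 - cstar_adj b * b) * g
      = cstar_adj g * g - (cstar_adj g * cstar_adj b) * (b * g)"
    by (simp add: left_diff_distrib right_diff_distrib mult.assoc)
  also have "\<dots> = g + cstar_adj g - 1"
    unfolding bg gb by (simp add: algebra_simps)
  finally show ?thesis .
qed

section \<open>Roots of unity and the discrete Poisson kernel\<close>

lemma root_of_unity_sums:
  assumes "N > 0"
  shows "\<exists>\<zeta>. cmod \<zeta> = 1 \<and> (\<forall>j. 0 < j \<and> j < N \<longrightarrow> (\<Sum>k<N. \<zeta> ^ (k * j)) = 0)"
proof -
  define \<zeta> where "\<zeta> = exp (2 * of_real pi * \<i> * of_nat 1 / of_nat N)"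
  have pow: "\<zeta> ^ j = exp (2 * of_real pi * \<i> * of_nat j / of_nat N)" for j
    unfolding \<zeta>_def by (simp flip: exp_of_nat_mult add: mult_ac)
  have "(\<Sum>k<N. \<zeta> ^ (k * j)) = 0" if "0 < j" "j < N" for j
  proof -
    have ne: "\<zeta> ^ j \<noteq> 1"
      unfolding pow using complex_root_unity_eq_1[of N j] that by (auto dest: dvd_imp_le)
    have "(\<zeta> ^ j) ^ N = (\<zeta> ^ N) ^ j" by (simp add: mult.commute flip: power_mult)
    also have "\<zeta> ^ N = 1" unfolding pow using complex_root_unity_eq_1[of N N] assms by simp
    finally have "(\<zeta> ^ j) ^ N = 1" by simp
    then have "(\<Sum>k<N. (\<zeta> ^ j) ^ k) = 0" using ne by (simp add: geometric_sum)
    then show ?thesis by (simp add: mult.commute flip: power_mult)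
  qed
  moreover have "cmod \<zeta> = 1"
    unfolding \<zeta>_def by simp
  ultimately show ?thesis by blast
qed

lemma scal_mult_power: "(scal c * x) ^ n = scal (c ^ n) * (x::'a::cstar_algebra) ^ n"
  by (induction n) (simp_all add: scal_mult mult.assoc scal_left_commute[of x])

text \<open>After the interchange the inner sum runs over the roots of unity, so single coefficients
  of a truncated power series can be read off.\<close>

lemma sum_scal_swap:
  fixes x :: "nat \<Rightarrow> 'a::cstar_algebra"
  shows "(\<Sum>k<N. scal (c k) * (\<Sum>n<M. scal (d k n) * x n)) = (\<Sum>n<M. scal (\<Sum>k<N. c k * d k n) * x n)"
  unfolding sum_distrib_left scal_sum sum_distrib_right
  by (subst sum.swap) (simp add: scal_mult mult.assoc)

text \<open>A discrete Poisson kernel: \<open>R k\<close> is the operator Poisson kernel of \<open>a\<close> at the \<open>k\<close>-th root of unity, truncated so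
that no aliasing occurs and shifted by the truncation error to stay positive.\<close>

lemma poisson_partition:
  fixes a :: "'a::cstar_algebra"
  assumes a: "norm a < 1" and e: "e > 0"
  shows "\<exists>N R w. (\<forall>k<N. positive (R k) \<and> cmod (w k) = 1) \<and>
     (\<Sum>k<N. R k) = (1 + e) *\<^sub>R 1 \<and> (\<Sum>k<(N::nat). scal (w k) * R k) = a"
proof -
  have "(\<lambda>M. 2 * (norm a ^ M / (1 - norm a))) \<longlonglongrightarrow> 2 * (0 / (1 - norm a))"
    by (intro tendsto_intros LIMSEQ_power_zero) (use a in auto)
  then have "\<forall>\<^sub>F M in sequentially. 2 * (norm a ^ M / (1 - norm a)) < e"
    using e by (intro order_tendstoD) auto
  then obtain M0 where M0: "\<And>M. M \<ge> M0 \<Longrightarrow> 2 * (norm a ^ M / (1 - norm a)) < e"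
    by (auto simp: eventually_sequentially)
  \<comment> \<open>At least two terms are kept, so that the powers 0 and 1 of \<open>a\<close> are
    both present.\<close>
  define M where "M = max M0 2"
  have M2: "M \<ge> 2" and Me: "2 * (norm a ^ M / (1 - norm a)) < e"
    using M0[of M] by (auto simp: M_def)
  \<comment> \<open>The exponents to be separated go up to \<open>M\<close>, reached in the adjoint
    half after multiplication by \<open>\<zeta> ^ k\<close>; all must stay below
    \<open>N\<close>.\<close>
  define N where "N = M + 1"
  have N: "N > 0" by (simp add: N_def)
  obtain \<zeta> where \<zeta>: "cmod \<zeta> = 1" and z0: "\<And>j. 0 < j \<Longrightarrow> j < N \<Longrightarrow> (\<Sum>k<N. \<zeta> ^ (k * j)) = 0"
    using root_of_unity_sums[OF N] by blast
  have z0': "(\<Sum>k<N. cnj \<zeta> ^ (k * j)) = 0" if "0 < j" "j < N" for j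
    using arg_cong[OF z0[OF that], of cnj] by simp
  have zz: "\<zeta> ^ j * cnj \<zeta> ^ j = 1" for j
    using \<zeta> by (metis complex_norm_square of_real_1 power_mult_distrib power_one)
  define G where "G k = (\<Sum>n<M. scal (cnj \<zeta> ^ (k * n)) * a ^ n)" for k
  have Gadj: "cstar_adj (G k) = (\<Sum>n<M. scal (\<zeta> ^ (k * n)) * cstar_adj a ^ n)" for k
    unfolding G_def adj_sum by (simp add: adj_mult adj_scal adj_power scal_central)
  define R where "R k = (1 / real N) *\<^sub>R (G k + cstar_adj (G k) - 1 + e *\<^sub>R 1)" for k

  have "positive (R k)" for k
  proof -
    define b where "b = scal (cnj \<zeta> ^ k) * a"
    have nb: "norm b = norm a" using \<zeta> by (simp add: b_def norm_power)
    obtain g where g: "g * (1 - b) = 1" "(1 - b) * g = 1" "norm g \<le> 1 / (1 - norm a)"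
      using neumann_bound[of b] nb a by auto
    have bn: "b ^ n = scal (cnj \<zeta> ^ (k * n)) * a ^ n" for n
      unfolding power_mult b_def by (rule scal_mult_power)
    have "(\<Sum>n<M. b ^ n) * ((1 - b) * g) = (1 - b ^ M) * g"
      by (simp add: geometric_partial_sum flip: mult.assoc)
    then have "(\<Sum>n<M. b ^ n) = g - b ^ M * g" unfolding g(2) by (simp add: left_diff_distrib)
    then have G: "G k = g - b ^ M * g" by (simp add: G_def bn)
    \<comment> \<open>\<open>r\<close> is the tail of the series; cutting it and its adjoint off the
      Poisson kernel costs at most \<open>e\<close>, which the shift by \<open>e\<close>
      repays.\<close>
    define r where "r = b ^ M * g"
    have "norm r \<le> norm b ^ M * (1 / (1 - norm a))"
      unfolding r_def by (intro order_trans[OF norm_mult_ineq] mult_mono norm_power_ineq g) auto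
    then have "norm (r + cstar_adj r) \<le> e"
      using Me nb norm_triangle_ineq[of r "cstar_adj r"] by simp
    then have "positive (e *\<^sub>R 1 - (r + cstar_adj r))"
      by (intro positive_shift_of_norm_le) (simp_all add: adj_simps add.commute)
    moreover have "positive (g + cstar_adj g - 1)"
      using g nb a by (intro positive_poisson_kernel[of b g]) auto
    ultimately have "positive ((1 / real N) *\<^sub>R ((e *\<^sub>R 1 - (r + cstar_adj r)) + (g + cstar_adj g - 1)))"
      by (intro positive_scaleR positive_add) auto
    then show ?thesis by (simp add: R_def G r_def adj_diff algebra_simps)
  qed
  moreover have "cmod (\<zeta> ^ k) = 1" for k using \<zeta> by (simp add: norm_power)
  moreover have "(\<Sum>k<N. R k) = (1 + e) *\<^sub>R 1"
  proof -
    have s1: "(\<Sum>k<N. 1 * cnj \<zeta> ^ (k * n)) = (if n = 0 then of_nat N else 0)" if "n < M" for n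
      using z0'[of n] that by (simp add: N_def)
    have d: "(\<Sum>n<M. scal (if n = 0 then of_nat N else 0) * y ^ n) = real N *\<^sub>R (1::'a)" for y
    proof -
      have "(\<Sum>n<M. scal (if n = 0 then of_nat N else 0) * y ^ n)
          = (\<Sum>n<M. if n = 0 then scal (of_real (real N)) else 0)"
        by (intro sum.cong) auto
      also have "\<dots> = real N *\<^sub>R 1" unfolding scal_of_real using M2 by simp
      finally show ?thesis .
    qed
    have G1: "(\<Sum>k<N. G k) = real N *\<^sub>R 1"
      using sum_scal_swap[of "\<lambda>_. 1" "\<lambda>k n. cnj \<zeta> ^ (k * n)" "\<lambda>n. a ^ n" M N] d[of a] s1
      by (simp add: G_def cong: sum.cong_simp)
    have G2: "(\<Sum>k<N. cstar_adj (G k)) = real N *\<^sub>R 1"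
      using arg_cong[OF G1, of cstar_adj] by (simp add: adj_sum adj_scaleR)
    have "(\<Sum>k<N. R k) = (1 / real N) *\<^sub>R ((\<Sum>k<N. G k) + (\<Sum>k<N. cstar_adj (G k))
       - real N *\<^sub>R 1 + real N *\<^sub>R (e *\<^sub>R 1))"
      unfolding R_def scaleR_sum_right[symmetric] sum.distrib sum_subtractf
      by (simp only: sum_constant_scaleR card_lessThan scaleR_left_commute)
    also have "\<dots> = (1 + e) *\<^sub>R 1" unfolding G1 G2 using N by (simp add: algebra_simps)
    finally show ?thesis .
  qed
  moreover have "(\<Sum>k<N. scal (\<zeta> ^ k) * R k) = a"
  proof -
    have s0: "(\<Sum>k<N. \<zeta> ^ k) = 0" using z0[of 1] M2 by (simp add: N_def)
    \<comment> \<open>The factor \<open>\<zeta> ^ k\<close> moves the surviving coefficient from n =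
      0 to n = 1, which selects \<open>a\<close> itself.\<close>
    have s1: "(\<Sum>k<N. \<zeta> ^ k * cnj \<zeta> ^ (k * n)) = (if n = 1 then of_nat N else 0)" if "n < M" for n
    proof (cases n)
      case 0
      then show ?thesis using s0 by simp
    next
      case (Suc j)
      have "\<zeta> ^ k * cnj \<zeta> ^ (k * n) = cnj \<zeta> ^ (k * j)" for k
        using zz[of k] by (simp add: Suc power_add)
      then show ?thesis using z0'[of j] that Suc by (cases "j = 0") (auto simp: N_def)
    qed
    \<comment> \<open>The exponents in the adjoint half are n + 1, strictly between 0 and N, so no
      coefficient survives.\<close>
    have s2: "(\<Sum>k<N. \<zeta> ^ k * \<zeta> ^ (k * n)) = 0" if "n < M" for n
      using z0[of "Suc n"] that by (simp add: N_def power_add)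
    have G1: "(\<Sum>k<N. scal (\<zeta> ^ k) * G k) = real N *\<^sub>R a"
    proof -
      have "(\<Sum>k<N. scal (\<zeta> ^ k) * G k)
          = (\<Sum>n<M. scal (\<Sum>k<N. \<zeta> ^ k * cnj \<zeta> ^ (k * n)) * a ^ n)"
        unfolding G_def by (rule sum_scal_swap)
      also have "\<dots> = (\<Sum>n<M. if n = 1 then scal (of_real (real N)) * a else 0)"
        by (intro sum.cong) (auto simp: s1)
      also have "\<dots> = real N *\<^sub>R a" unfolding scal_of_real using M2 by simp
      finally show ?thesis .
    qed
    have G2: "(\<Sum>k<N. scal (\<zeta> ^ k) * cstar_adj (G k)) = 0"
      unfolding Gadj sum_scal_swap by (simp add: s2)
    have "(\<Sum>k<N. scal (\<zeta> ^ k) * R k) = (1 / real N) *\<^sub>R ((\<Sum>k<N. scal (\<zeta> ^ k) * G k)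
       + (\<Sum>k<N. scal (\<zeta> ^ k) * cstar_adj (G k)) + scal (\<Sum>k<N. \<zeta> ^ k) * (e *\<^sub>R 1 - 1))"
      unfolding R_def scal_sum
      by (simp add: sum.distrib sum_subtractf right_diff_distrib distrib_left sum_distrib_right
          scaleR_sum_right scaleR_add_right scaleR_diff_right)
    also have "\<dots> = a" unfolding G1 G2 s0 using N by simp
    finally show ?thesis .
  qed
  ultimately show ?thesis
    by (intro exI[of _ N] exI[of _ R] exI[of _ "\<lambda>k. \<zeta> ^ k"] conjI allI impI)
qed

section \<open>Linear maps, and norm bounds for positive maps\<close>

lemma clinear_map_add: "clinear_map f \<Longrightarrow> f (x + y) = f x + f y"
  by (simp add: clinear_map_def)

lemma clinear_map_scal: "clinear_map f \<Longrightarrow> f (scal c * x) = scal c * f x"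
  unfolding clinear_map_def by (metis cscale_eq_scal_mult)

lemma clinear_map_scaleR: "clinear_map f \<Longrightarrow> f (r *\<^sub>R x) = r *\<^sub>R f x"
  using clinear_map_scal[of f "of_real r" x] by (simp add: scal_of_real)

lemma clinear_map_diff: "clinear_map f \<Longrightarrow> f (x - y) = f x - f y"
  using clinear_map_add[of f x "(-1) *\<^sub>R y"] clinear_map_scaleR[of f "-1" y] by simp

lemma clinear_map_sum:
  assumes "clinear_map f"
  shows "f (sum g A) = (\<Sum>i\<in>A. f (g i))"
proof -
  have "f 0 = 0" using clinear_map_diff[OF assms, of 0 0] by simp
  then show ?thesis
    by (induction A rule: infinite_finite_induct) (auto simp: clinear_map_add[OF assms])
qed

lemma positive_map_clinear: "positive_map f \<Longrightarrow> clinear_map f"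
  by (simp add: positive_map_def)

lemma positive_mapD: "positive_map f \<Longrightarrow> positive x \<Longrightarrow> positive (f x)"
  by (simp add: positive_map_def)

text \<open>For |a| < 1, applying \<psi> to the partition of \<open>poisson_partition\<close> gives
  a unimodular combination of positive elements with sum (1 + e) \<psi>(1) <= T (1 + e). Then e
  tends to 0, and scaling handles general a.\<close>

lemma positive_map_norm_le:
  fixes \<psi> :: "'a::cstar_algebra \<Rightarrow> 'a"
  assumes \<psi>: "positive_map \<psi>" and T: "T > 0" "positive (T *\<^sub>R 1 - \<psi> 1)"
  shows "norm (\<psi> a) \<le> T * norm a"
proof -
  note lin = positive_map_clinear[OF \<psi>]
  have approx: "norm (\<psi> a) \<le> T * (1 + e)" if a: "norm a < 1" and e: "e > 0" for a e
  proof -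
    from poisson_partition[OF a e] obtain N :: nat and R w
      where R: "\<And>k. k < N \<Longrightarrow> positive (R k)" "\<And>k. k < N \<Longrightarrow> cmod (w k) = 1"
        and R1: "(\<Sum>k<N. R k) = (1 + e) *\<^sub>R 1" and Ra: "(\<Sum>k<N. scal (w k) * R k) = a"
      by blast
    have "(\<Sum>k<N. \<psi> (R k)) = (1 + e) *\<^sub>R \<psi> 1"
      using arg_cong[OF R1, of \<psi>] by (simp add: clinear_map_sum[OF lin] clinear_map_scaleR[OF lin])
    moreover have "positive ((1 + e) *\<^sub>R (T *\<^sub>R 1 - \<psi> 1))"
      using e T by (intro positive_scaleR) auto
    ultimately have "positive ((T * (1 + e)) *\<^sub>R 1 - (\<Sum>k<N. \<psi> (R k)))"
      by (simp add: scaleR_diff_right mult.commute)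
    then have "norm (\<Sum>k<N. scal (w k) * \<psi> (R k)) \<le> T * (1 + e)"
      using R e T by (intro norm_unimodular_combination_le positive_mapD[OF \<psi>]) auto
    moreover have "(\<Sum>k<N. scal (w k) * \<psi> (R k)) = \<psi> a"
      using arg_cong[OF Ra, of \<psi>] by (simp add: clinear_map_sum[OF lin] clinear_map_scal[OF lin])
    ultimately show ?thesis by simp
  qed
  have unit: "norm (\<psi> a) \<le> T" if a: "norm a < 1" for a
  proof (rule field_le_epsilon)
    fix d :: real assume "d > 0"
    then show "norm (\<psi> a) \<le> T + d" using approx[OF a, of "d / T"] T by (simp add: distrib_left)
  qed
  show ?thesis
  proof (rule field_le_epsilon)
    fix d :: real assume d: "d > 0"
    \<comment> \<open>Strictly above \<open>norm a\<close>, so the rescaled element lies in the open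
      unit ball, also for a = 0; the excess contributes exactly \<open>d\<close> after
      multiplication by \<open>T\<close>.\<close>
    define r where "r = norm a + d / T"
    have r: "r > norm a" "r > 0" using d T by (auto simp: r_def add_nonneg_pos)
    have "norm (\<psi> ((1/r) *\<^sub>R a)) \<le> T" using r by (intro unit) simp
    then have "norm (\<psi> a) \<le> T * r" using r by (simp add: clinear_map_scaleR[OF lin] divide_le_eq)
    also have "\<dots> = T * norm a + d" using T by (simp add: r_def distrib_left)
    finally show "norm (\<psi> a) \<le> T * norm a + d" .
  qed
qed

lemma positive_map_bounded:
  assumes "positive_map \<psi>"
  shows "\<exists>K>0. \<forall>x. norm (\<psi> x) \<le> K * norm x"
proof -
  \<comment> \<open>The added 1 keeps the constant positive even when \<psi>(1) = 0.\<close>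
  let ?K = "norm (\<psi> 1) + 1"
  have "positive (\<psi> 1)"
    using positive_mapD[OF assms] positive_scaleR_one[of 1] by simp
  then have "positive (?K *\<^sub>R 1 - \<psi> 1)"
    by (intro positive_shift_of_norm_le positive_self_adj) auto
  then have "\<forall>x. norm (\<psi> x) \<le> ?K * norm x"
    using positive_map_norm_le[OF assms, of ?K] by (simp add: add_nonneg_pos)
  then show ?thesis by (intro exI[of _ ?K]) (simp add: add_nonneg_pos)
qed

lemma positive_map_bounded_linear:
  assumes "positive_map \<psi>"
  shows "bounded_linear \<psi>"
proof -
  obtain K where K: "\<forall>x. norm (\<psi> x) \<le> K * norm x" using positive_map_bounded[OF assms] by blast
  note lin = positive_map_clinear[OF assms]
  show ?thesis
    by (rule bounded_linear_intro[where K = K])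
      (use K in \<open>auto simp: clinear_map_add[OF lin] clinear_map_scaleR[OF lin] mult.commute\<close>)
qed

lemma positive_map_adj:
  fixes \<psi> :: "'a::cstar_algebra \<Rightarrow> 'a"
  assumes \<psi>: "positive_map \<psi>"
  shows "\<psi> (cstar_adj x) = cstar_adj (\<psi> x)"
proof -
  note lin = positive_map_clinear[OF \<psi>]
  have sa: "self_adj (\<psi> h)" if "self_adj h" for h
  proof -
    have p: "positive (norm h *\<^sub>R 1 + h)" "positive (norm h *\<^sub>R (1::'a))"
      using that by (auto intro: positive_shift_of_norm_le positive_scaleR_one)
    have "\<psi> h = \<psi> (norm h *\<^sub>R 1 + h) - \<psi> (norm h *\<^sub>R 1)"
      by (simp flip: clinear_map_diff[OF lin])
    then show ?thesis
      using positive_self_adj[OF positive_mapD[OF \<psi> p(1)]]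
        positive_self_adj[OF positive_mapD[OF \<psi> p(2)]] by (simp add: adj_diff)
  qed
  define A B where "A = \<psi> x" and "B = \<psi> (cstar_adj x)"
  have "self_adj (\<psi> (x + cstar_adj x))"
    by (rule sa) (simp add: adj_simps add.commute)
  then have 1: "cstar_adj A + cstar_adj B = A + B"
    by (simp add: A_def B_def clinear_map_add[OF lin] adj_add)
  have ci: "ci = (scal \<i> :: 'a)" by (simp add: cscale_def)
  have "self_adj (\<psi> (scal \<i> * (x - cstar_adj x)))"
    by (rule sa) (simp add: adj_simps adj_ci ci_central algebra_simps flip: ci)
  moreover have "\<psi> (scal \<i> * (x - cstar_adj x)) = ci * (A - B)"
    by (simp only: clinear_map_scal[OF lin] clinear_map_diff[OF lin] A_def B_def ci)
  ultimately have "self_adj (ci * (A - B))" by metis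
  then have "ci * (cstar_adj B - cstar_adj A) = ci * (A - B)"
    by (simp add: adj_simps adj_ci ci_central algebra_simps)
  then have "ci * (ci * (cstar_adj B - cstar_adj A)) = ci * (ci * (A - B))" by simp
  then have 2: "cstar_adj B - cstar_adj A = A - B"
    unfolding mult.assoc[symmetric] ci_sq by (simp add: algebra_simps)
  have "2 *\<^sub>R cstar_adj A = (cstar_adj A + cstar_adj B) - (cstar_adj B - cstar_adj A)"
    by (simp add: scaleR_2)
  also have "\<dots> = 2 *\<^sub>R B" unfolding 1 2 by (simp add: scaleR_2)
  finally show ?thesis by (simp add: A_def B_def)
qed

section \<open>Elementary similarity\<close>

lemma alpha_alpha_inv:
  assumes "cinvertible a"
  shows "alpha a (alpha_inv a x) = x" "alpha_inv a (alpha a x) = x"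
proof -
  note a = cinv[OF assms]
  have a': "cstar_adj a * cstar_adj (cinv a) = 1" "cstar_adj (cinv a) * cstar_adj a = 1"
    using a by (metis adj_mult adj_one)+
  show "alpha a (alpha_inv a x) = x" "alpha_inv a (alpha a x) = x"
    unfolding alpha_def alpha_inv_def using a a'
    by (metis mult.assoc mult.left_neutral mult.right_neutral)+
qed

lemma bij_alpha:
  assumes "cinvertible a"
  shows "bij (alpha a)" "bij (alpha_inv a)"
  using alpha_alpha_inv[OF assms] by (metis bijI' )+

lemma cinvertible_cinv:
  assumes "cinvertible a"
  shows "cinvertible (cinv a)" "cinv (cinv a) = a"
  using cinv[OF assms] cinv_unique cinvertibleI by metis+

lemma alpha_cinv:
  assumes "cinvertible a"
  shows "alpha (cinv a) = alpha_inv a" "alpha_inv (cinv a) = alpha a"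
  by (auto simp: fun_eq_iff alpha_def alpha_inv_def cinvertible_cinv[OF assms])

lemma clinear_map_conj: "clinear_map (\<lambda>x. a * x * b)"
  unfolding clinear_map_def
proof (intro conjI allI)
  show "a * cscale c x * b = cscale c (a * x * b)" for c x
    unfolding cscale_eq_scal_mult[of c x] cscale_eq_scal_mult[of c "a * x * b"]
    by (simp add: scal_left_commute mult.assoc)
qed (simp add: algebra_simps)

lemma clinear_map_alpha: "clinear_map (alpha a)" "clinear_map (alpha_inv a)"
  using clinear_map_conj[of "cstar_adj a" a] clinear_map_conj[of "cstar_adj (cinv a)" "cinv a"]
  unfolding alpha_def[abs_def] alpha_inv_def[abs_def] by auto

lemma positive_alpha: "positive x \<Longrightarrow> positive (alpha a x)" "positive x \<Longrightarrow> positive (alpha_inv a x)"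
  by (simp_all add: alpha_def alpha_inv_def positive_conj)

lemma positive_map_similar:
  assumes "positive_map \<phi>"
  shows "positive_map (alpha_inv a \<circ> \<phi> \<circ> alpha a)"
proof -
  have "clinear_map (alpha_inv a \<circ> \<phi> \<circ> alpha a)"
    using positive_map_clinear[OF assms] clinear_map_alpha[of a] by (simp add: clinear_map_def)
  then show ?thesis
    using positive_mapD[OF assms] by (simp add: positive_map_def positive_alpha)
qed

lemma similar_shift:
  assumes "cinvertible a" "\<psi> = alpha_inv a \<circ> \<phi> \<circ> alpha a"
  shows "\<phi> x - cscale c x = alpha a (\<psi> (alpha_inv a x) - cscale c (alpha_inv a x))"
  using clinear_map_alpha(1)[of a]
  by (simp add: assms(2) alpha_alpha_inv[OF assms(1)] clinear_map_diff clinear_map_def)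

lemma op_spectrum_similar_subset:
  assumes "cinvertible a" "\<psi> = alpha_inv a \<circ> \<phi> \<circ> alpha a"
  shows "op_spectrum \<phi> \<subseteq> op_spectrum \<psi>"
proof -
  have "bij (\<lambda>x. \<phi> x - cscale c x)" if "bij (\<lambda>x. \<psi> x - cscale c x)" for c
  proof -
    have "(\<lambda>x. \<phi> x - cscale c x) = alpha a \<circ> (\<lambda>x. \<psi> x - cscale c x) \<circ> alpha_inv a"
      using similar_shift[OF assms] by (simp add: fun_eq_iff)
    then show ?thesis using that bij_alpha[OF assms(1)] by (simp add: bij_comp)
  qed
  then show ?thesis by (auto simp: op_spectrum_def)
qed

section \<open>Resolvents of positive maps\<close>

text \<open>Bijectivity is Banach's fixed point theorem for x -> y + g x. For positivity, x - g^n x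
  is the sum of g^i (x - g x) over i < n, hence positive, and it tends to x.\<close>

lemma contraction_solve:
  fixes g :: "'a::cstar_algebra \<Rightarrow> 'a"
  assumes add: "\<And>x y. g (x - y) = g x - g y" and bd: "\<And>x. norm (g x) \<le> q * norm x" and q: "0 \<le> q" "q < 1"
  shows "bij (\<lambda>x. x - g x)"
    and "(\<And>x. positive x \<Longrightarrow> positive (g x)) \<Longrightarrow> positive (x - g x) \<Longrightarrow> positive x"
proof -
  have "\<exists>!x. y + g x = x" for y
    by (rule banach_fix_type[OF q]) (simp add: dist_norm bd flip: add)
  moreover have "y + g x = x \<longleftrightarrow> x - g x = y" for x y by (auto simp: algebra_simps)
  ultimately show "bij (\<lambda>x. x - g x)" by (simp add: bij_iff)
next
  assume pos: "\<And>x. positive x \<Longrightarrow> positive (g x)" and p: "positive (x - g x)"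
  have norm: "norm ((g ^^ n) x) \<le> q ^ n * norm x" for n
  proof (induction n)
    case (Suc n)
    have "norm ((g ^^ Suc n) x) \<le> q * norm ((g ^^ n) x)" by (simp add: bd)
    also have "\<dots> \<le> q * (q ^ n * norm x)" using Suc q by (intro mult_left_mono)
    finally show ?case by (simp add: mult.assoc)
  qed simp
  have "(\<lambda>n. q ^ n * norm x) \<longlonglongrightarrow> 0 * norm x"
    using q by (intro tendsto_intros LIMSEQ_power_zero) auto
  then have "(\<lambda>n. (g ^^ n) x) \<longlonglongrightarrow> 0"
    by (intro Lim_null_comparison[of "\<lambda>n. (g ^^ n) x"]) (use norm in auto)
  then have lim: "(\<lambda>n. x - (g ^^ n) x) \<longlonglongrightarrow> x"
    using tendsto_diff[OF tendsto_const, of "\<lambda>n. (g ^^ n) x" 0 sequentially x] by simp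
  have "positive (x - (g ^^ n) x)" for n
  proof (induction n)
    case (Suc n)
    have "positive ((x - g x) + g (x - (g ^^ n) x))" by (intro positive_add pos p Suc)
    then show ?case by (simp add: add)
  qed (simp add: positive_zero)
  then show "positive x" using lim by (rule positive_limit)
qed

lemma bij_scal_mult: "c \<noteq> 0 \<Longrightarrow> bij (\<lambda>x::'a::cstar_algebra. scal c * x)"
  by (rule bij_betw_byWitness[where f' = "\<lambda>x. scal (1 / c) * x"])
    (auto simp flip: mult.assoc scal_mult)

text \<open>For |c| > K, f - c = -c (1 - f / c), where f / c is a strict contraction.\<close>

lemma op_spectrum_bounded:
  assumes lin: "clinear_map f" and bd: "\<And>x. norm (f x) \<le> K * norm x" and c: "c \<in> op_spectrum f"
  shows "cmod c \<le> K"
proof (rule ccontr)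
  assume "\<not> cmod c \<le> K"
  then have K: "K < cmod c" by simp
  have K0: "0 \<le> K" using order_trans[OF norm_ge_zero bd[of 1]] by simp
  then have c0: "c \<noteq> 0" using K by auto
  define g where "g x = scal (1 / c) * f x" for x
  have "bij (\<lambda>x. x - g x)"
  proof (rule contraction_solve(1))
    show "norm (g x) \<le> (K / cmod c) * norm x" for x
      using bd[of x] c0 by (simp add: g_def norm_divide divide_right_mono)
  qed (use K K0 c0 in \<open>auto simp: g_def clinear_map_diff[OF lin] right_diff_distrib\<close>)
  then have "bij ((\<lambda>x. scal (- c) * x) \<circ> (\<lambda>x. x - g x))"
    using c0 by (intro bij_comp bij_scal_mult) auto
  also have "(\<lambda>x. scal (- c) * x) \<circ> (\<lambda>x. x - g x) = (\<lambda>x. f x - cscale c x)"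
  proof
    fix x
    have "scal (- c) * g x = scal (- c * (1 / c)) * f x"
      by (simp only: g_def scal_mult mult.assoc)
    also have "- c * (1 / c) = of_real (- 1)" using c0 by simp
    finally have "scal (- c) * g x = - f x" unfolding scal_of_real by simp
    moreover have "scal (- c) * x = - cscale c x" by (simp add: cscale_def algebra_simps)
    ultimately show "((\<lambda>x. scal (- c) * x) \<circ> (\<lambda>x. x - g x)) x = f x - cscale c x"
      by (simp add: right_diff_distrib)
  qed
  finally show False using c by (simp add: op_spectrum_def)
qed

lemma cscale_of_real: "cscale (of_real r) x = r *\<^sub>R (x::'a::cstar_algebra)"
  by (simp add: cscale_def)

lemma bij_resolvent_iff:
  "bij (\<lambda>x. r *\<^sub>R x - f x) \<longleftrightarrow> complex_of_real r \<notin> op_spectrum (f :: 'a::cstar_algebra \<Rightarrow> 'a)"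
proof -
  have u: "bij (uminus :: 'a \<Rightarrow> 'a)" by (rule bij_uminus)
  let ?P = "\<lambda>x. r *\<^sub>R x - f x" and ?Q = "\<lambda>x. f x - cscale (of_real r) x"
  have Q: "?Q = uminus \<circ> ?P"
    by (simp add: fun_eq_iff cscale_of_real)
  have P: "?P = uminus \<circ> ?Q"
    by (simp add: fun_eq_iff cscale_of_real)
  have "bij ?P \<longleftrightarrow> bij ?Q"
  proof
    assume "bij ?P"
    then show "bij ?Q" unfolding Q by (rule bij_comp[OF _ u])
  next
    assume "bij ?Q"
    then have "bij (uminus \<circ> ?Q)" by (rule bij_comp[OF _ u])
    then show "bij ?P" unfolding P .
  qed
  then show ?thesis by (simp add: op_spectrum_def)
qed

text \<open>The second clause expresses that the inverse of r - \<phi> preserves positivity, without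
  naming that inverse.\<close>

definition positive_resolvent :: "('a::cstar_algebra \<Rightarrow> 'a) \<Rightarrow> real \<Rightarrow> bool" where
  "positive_resolvent \<phi> r \<longleftrightarrow> bij (\<lambda>x. r *\<^sub>R x - \<phi> x) \<and> (\<forall>x. positive (r *\<^sub>R x - \<phi> x) \<longrightarrow> positive x)"

lemma positive_resolvent_of_bound:
  assumes \<psi>: "positive_map \<psi>" and bd: "\<And>x. norm (\<psi> x) \<le> K * norm x" and r: "K < r" "0 \<le> K"
  shows "positive_resolvent \<psi> r"
  unfolding positive_resolvent_def
proof (intro conjI allI impI)
  show "bij (\<lambda>x. r *\<^sub>R x - \<psi> x)"
    unfolding bij_resolvent_iff
    using op_spectrum_bounded[OF positive_map_clinear[OF \<psi>] bd, of "of_real r"] r by auto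
next
  fix x assume p: "positive (r *\<^sub>R x - \<psi> x)"
  note lin = positive_map_clinear[OF \<psi>]
  define g where "g x = (1/r) *\<^sub>R \<psi> x" for x
  show "positive x"
  proof (rule contraction_solve(2)[of g "K / r"])
    show "norm (g x) \<le> K / r * norm x" for x
      using bd[of x] r by (simp add: g_def divide_right_mono)
    show "positive (g x)" if "positive x" for x
      using positive_mapD[OF \<psi> that] r by (simp add: g_def positive_scaleR)
    have "positive ((1/r) *\<^sub>R (r *\<^sub>R x - \<psi> x))" using p r by (intro positive_scaleR) auto
    then show "positive (x - g x)" using r by (simp add: g_def scaleR_diff_right)
  qed (use r in \<open>auto simp: g_def clinear_map_diff[OF lin] scaleR_diff_right\<close>)
qed

text \<open>\<open>alpha_inv a\<close> intertwines r - \<phi> with r - \<psi>, and conjugation in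
  either direction preserves positivity.\<close>

lemma positive_resolvent_similar:
  assumes a: "cinvertible a" and \<psi>: "\<psi> = alpha_inv a \<circ> \<phi> \<circ> alpha a" and res: "positive_resolvent \<psi> r"
  shows "positive_resolvent \<phi> r"
  unfolding positive_resolvent_def
proof (intro conjI allI impI)
  show "bij (\<lambda>x. r *\<^sub>R x - \<phi> x)"
    using res op_spectrum_similar_subset[OF a \<psi>] by (auto simp: positive_resolvent_def bij_resolvent_iff)
next
  fix x assume p: "positive (r *\<^sub>R x - \<phi> x)"
  have eq: "r *\<^sub>R alpha_inv a x - \<psi> (alpha_inv a x) = alpha_inv a (r *\<^sub>R x - \<phi> x)"
    by (simp add: \<psi> alpha_alpha_inv[OF a] clinear_map_diff[OF clinear_map_alpha(2)]
        clinear_map_scaleR[OF clinear_map_alpha(2)])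
  have "positive (r *\<^sub>R alpha_inv a x - \<psi> (alpha_inv a x))"
    unfolding eq by (rule positive_alpha(2)[OF p])
  then have "positive (alpha_inv a x)"
    using res unfolding positive_resolvent_def by blast
  then have "positive (alpha a (alpha_inv a x))" by (rule positive_alpha)
  then show "positive x" by (simp add: alpha_alpha_inv[OF a])
qed

text \<open>Take \<open>v = w\<^sup>1\<^sup>/\<^sup>2\<close>: the conjugated map sends \<open>1\<close> to \<open>v\<^sup>-\<^sup>1 \<phi>(w) v\<^sup>-\<^sup>1 = s (1 - w\<^sup>-\<^sup>1)\<close>, and \<open>w\<^sup>-\<^sup>1 \<ge> 1 / \<parallel>w\<parallel>\<close>.\<close>

lemma similar_contraction:
  fixes \<phi> :: "'a::cstar_algebra \<Rightarrow> 'a"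
  assumes \<phi>: "positive_map \<phi>" and s: "s > 0" and w: "positive w" "\<phi> w = s *\<^sub>R (w - 1)"
  shows "\<exists>v K. strictly_positive v \<and> 0 \<le> K \<and> K < s \<and>
     (\<forall>x. norm ((alpha_inv v \<circ> \<phi> \<circ> alpha v) x) \<le> K * norm x)"
proof -
  have "positive ((1/s) *\<^sub>R \<phi> w)" using s by (intro positive_scaleR positive_mapD[OF \<phi>] w) auto
  then have w1: "positive (w - 1)" using s by (simp add: w(2))
  then have wi: "cinvertible w" using cinvertible_positive_add[of "w - 1" 1] by simp
  obtain v where v: "positive v" "v * v = w" using positive_sqrt[OF w(1)] by blast
  have vi: "cinvertible v"
    by (rule cinvertibleI[of v "v * cinv w" "cinv w * v"]) (use cinv[OF wi] v(2) in \<open>metis mult.assoc\<close>)+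
  define u where "u = cinv v"
  have u: "u * v = 1" "v * u = 1" "self_adj u"
    using cinv[OF vi] cinv_self_adj[OF vi positive_self_adj[OF v(1)]] by (auto simp: u_def)
  have uwu: "u * w * u = 1" using u v(2) by (metis mult.assoc mult.right_neutral)
  define M where "M = norm w"
  have "w \<noteq> 0" using cinv(1)[OF wi] by auto
  then have M: "M > 0" by (simp add: M_def)
  have "positive (M *\<^sub>R 1 - w)"
    unfolding M_def by (intro positive_shift_of_norm_le positive_self_adj w) simp
  then have "positive (u * (M *\<^sub>R 1 - w) * u)" using positive_conj[of "M *\<^sub>R 1 - w" u] u(3) by simp
  also have "u * (M *\<^sub>R 1 - w) * u = M *\<^sub>R (u * u) - 1"
    using uwu by (simp add: left_diff_distrib right_diff_distrib)
  finally have "positive ((s / M) *\<^sub>R (M *\<^sub>R (u * u) - 1))" using s M by (intro positive_scaleR) auto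
  then have 1: "positive (s *\<^sub>R (u * u) - (s / M) *\<^sub>R 1)" using M by (simp add: scaleR_diff_right)
  define \<psi> where "\<psi> = alpha_inv v \<circ> \<phi> \<circ> alpha v"
  have "\<psi> 1 = u * (s *\<^sub>R (w - 1)) * u"
    by (simp add: \<psi>_def alpha_def alpha_inv_def positive_self_adj[OF v(1)] v(2) w(2) u(3) flip: u_def)
  also have "\<dots> = s *\<^sub>R 1 - s *\<^sub>R (u * u)"
    using uwu by (simp add: left_diff_distrib right_diff_distrib scaleR_diff_right)
  finally have \<psi>1: "\<psi> 1 = s *\<^sub>R 1 - s *\<^sub>R (u * u)" .
  \<comment> \<open>\<open>s - s / M\<close> is 0 for w = 1, whereas
    \<open>positive_map_norm_le\<close> takes a positive constant; \<open>s / 2\<close> secures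
    this.\<close>
  define K where "K = max (s - s / M) (s / 2)"
  have K: "K > 0" "K < s" using s M by (auto simp: K_def less_max_iff_disj)
  have "positive ((K - (s - s / M)) *\<^sub>R 1 + (s *\<^sub>R (u * u) - (s / M) *\<^sub>R 1))"
    by (intro positive_add 1 positive_scaleR_one) (simp add: K_def)
  also have "(K - (s - s / M)) *\<^sub>R 1 + (s *\<^sub>R (u * u) - (s / M) *\<^sub>R 1) = K *\<^sub>R 1 - \<psi> 1"
    unfolding \<psi>1 by (simp add: algebra_simps)
  finally have "norm (\<psi> x) \<le> K * norm x" for x
    using positive_map_norm_le[OF positive_map_similar[OF \<phi>, of v, folded \<psi>_def] K(1)] by blast
  then show ?thesis
    using K v vi by (intro exI[of _ v] exI[of _ K]) (simp add: strictly_positive_def flip: \<psi>_def)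
qed

text \<open>The conjugated map has norm at most some K < s, so its Neumann series gives positive
  resolvents for all r > K; these transfer back along the similarity.\<close>

lemma positive_resolvent_open:
  assumes \<phi>: "positive_map \<phi>" and s: "s > 0" and w: "positive w" "\<phi> w = s *\<^sub>R (w - 1)"
  shows "\<exists>K<s. \<forall>r>K. positive_resolvent \<phi> r"
proof -
  obtain v K where v: "strictly_positive v" and K: "0 \<le> K" "K < s"
    and bd: "\<And>x. norm ((alpha_inv v \<circ> \<phi> \<circ> alpha v) x) \<le> K * norm x"
    using similar_contraction[OF assms] by blast
  have "positive_resolvent \<phi> r" if "r > K" for r
  proof (rule positive_resolvent_similar[OF _ refl])
    show "cinvertible v" using v by (simp add: strictly_positive_def)
    show "positive_resolvent (alpha_inv v \<circ> \<phi> \<circ> alpha v) r"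
      by (rule positive_resolvent_of_bound[OF positive_map_similar[OF \<phi>] bd that K(1)])
  qed
  with K show ?thesis by blast
qed

text \<open>If \<open>y\<close> solves \<open>\<mu> y - \<phi> y = 1\<close> and \<open>r \<ge> \<mu>\<close> is close to \<open>\<mu>\<close>, then \<open>r y - \<phi> y = 1 + (r - \<mu>) y \<ge> 0\<close>.\<close>

lemma positive_resolvent_closed:
  fixes \<phi> :: "'a::cstar_algebra \<Rightarrow> 'a"
  assumes \<phi>: "positive_map \<phi>" and bij: "bij (\<lambda>x. \<mu> *\<^sub>R x - \<phi> x)"
    and near: "\<And>d. d > 0 \<Longrightarrow> \<exists>r. \<mu> \<le> r \<and> r < \<mu> + d \<and> positive_resolvent \<phi> r"
  shows "\<exists>y. positive y \<and> \<mu> *\<^sub>R y - \<phi> y = 1"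
proof -
  obtain y where y: "\<mu> *\<^sub>R y - \<phi> y = 1"
    using surjD[OF bij_is_surj[OF bij], of 1] by auto
  \<comment> \<open>The adjoint of \<open>y\<close> solves the same equation, so injectivity makes
    \<open>y\<close> self-adjoint.\<close>
  have "\<mu> *\<^sub>R cstar_adj y - \<phi> (cstar_adj y) = 1"
    using arg_cong[OF y, of cstar_adj] by (simp add: adj_simps positive_map_adj[OF \<phi>])
  with y have "\<mu> *\<^sub>R cstar_adj y - \<phi> (cstar_adj y) = \<mu> *\<^sub>R y - \<phi> y" by metis
  then have sa: "self_adj y" by (rule injD[OF bij_is_inj[OF bij]])
  obtain r where r: "\<mu> \<le> r" "r < \<mu> + 1 / (norm y + 1)" "positive_resolvent \<phi> r"
    using near[of "1 / (norm y + 1)"] by (auto simp: add_nonneg_pos)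
  have "(r - \<mu>) * norm y \<le> 1 / (norm y + 1) * norm y" using r by (intro mult_right_mono) auto
  also have "\<dots> \<le> 1" by (simp add: add_nonneg_pos)
  finally have "norm ((r - \<mu>) *\<^sub>R y) \<le> 1" using r by simp
  then have "positive (1 *\<^sub>R 1 + (r - \<mu>) *\<^sub>R y)"
    using sa by (intro positive_shift_of_norm_le) (simp_all add: adj_simps)
  also have "1 *\<^sub>R 1 + (r - \<mu>) *\<^sub>R y = r *\<^sub>R y - \<phi> y"
    by (simp add: scaleR_diff_left flip: y)
  finally have "positive y" using r(3) unfolding positive_resolvent_def by blast
  with y show ?thesis by blast
qed

lemma positive_solution_of_bij:
  fixes \<phi> :: "'a::cstar_algebra \<Rightarrow> 'a"
  assumes \<phi>: "positive_map \<phi>" and s: "s \<ge> 0" and bij: "\<And>r. r \<ge> s \<Longrightarrow> bij (\<lambda>x. r *\<^sub>R x - \<phi> x)"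
  shows "\<exists>y. positive y \<and> s *\<^sub>R y - \<phi> y = 1"
proof -
  \<comment> \<open>The infimum may equal \<open>s\<close> without belonging to \<open>E\<close>;
    the solution there comes from \<open>positive_resolvent_closed\<close>, not from
    membership.\<close>
  define E where "E = {r. r > s \<and> positive_resolvent \<phi> r}"
  define \<mu> where "\<mu> = Inf E"
  obtain K where "K > 0" and K: "\<And>x. norm (\<phi> x) \<le> K * norm x" using positive_map_bounded[OF \<phi>] by blast
  then have "max K s + 1 \<in> E"
    using positive_resolvent_of_bound[OF \<phi> K, of "max K s + 1"] by (auto simp: E_def)
  then have ne: "E \<noteq> {}" by blast
  have bdd: "bdd_below E" by (auto simp: E_def bdd_below_def intro!: exI[of _ s])
  have \<mu>s: "\<mu> \<ge> s" unfolding \<mu>_def by (rule cInf_greatest[OF ne]) (auto simp: E_def)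
  have "\<exists>y. positive y \<and> \<mu> *\<^sub>R y - \<phi> y = 1"
  proof (rule positive_resolvent_closed[OF \<phi> bij[OF \<mu>s]])
    fix d :: real assume "d > 0"
    then obtain r where "r \<in> E" "r < \<mu> + d"
      using cInf_lessD[OF ne, of "\<mu> + d"] by (auto simp: \<mu>_def)
    moreover have "\<mu> \<le> r" unfolding \<mu>_def using \<open>r \<in> E\<close> bdd by (rule cInf_lower)
    ultimately show "\<exists>r. \<mu> \<le> r \<and> r < \<mu> + d \<and> positive_resolvent \<phi> r" by (auto simp: E_def)
  qed
  then obtain y where y: "positive y" "\<mu> *\<^sub>R y - \<phi> y = 1" by blast
  have "\<mu> = s"
  proof (rule ccontr)
    assume "\<mu> \<noteq> s"
    then have \<mu>: "\<mu> > s" "\<mu> > 0" using \<mu>s s by auto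
    \<comment> \<open>Multiplying \<open>y\<close> by \<mu> brings the resolvent equation into the
      form required by \<open>positive_resolvent_open\<close>, which then pushes below the
      infimum.\<close>
    have "\<phi> y = \<mu> *\<^sub>R y - 1" using y(2) by (simp add: algebra_simps)
    then have "\<phi> (\<mu> *\<^sub>R y) = \<mu> *\<^sub>R (\<mu> *\<^sub>R y - 1)"
      by (simp add: clinear_map_scaleR[OF positive_map_clinear[OF \<phi>]])
    moreover have "positive (\<mu> *\<^sub>R y)" using y \<mu> by (intro positive_scaleR) auto
    ultimately obtain K' where K': "K' < \<mu>" "\<And>r. r > K' \<Longrightarrow> positive_resolvent \<phi> r"
      using positive_resolvent_open[OF \<phi> \<mu>(2)] by blast
    obtain r where r: "max K' s < r" "r < \<mu>" using dense[of "max K' s" \<mu>] K'(1) \<mu> by auto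
    then have "r \<in> E" using K'(2) by (simp add: E_def)
    then have "\<mu> \<le> r" unfolding \<mu>_def using bdd by (rule cInf_lower)
    with r show False by simp
  qed
  with y show ?thesis by blast
qed

section \<open>The spectral radius and the equivalences\<close>

lemma op_spectrum_nonempty:
  assumes \<phi>: "positive_map \<phi>"
  shows "op_spectrum \<phi> \<noteq> {}"
proof
  assume "op_spectrum \<phi> = {}"
  \<comment> \<open>With empty spectrum the descent reaches s = 0, where the positive solution would
    satisfy \<phi>(y) = -1.\<close>
  then obtain y where y: "positive y" "0 *\<^sub>R y - \<phi> y = 1"
    using positive_solution_of_bij[OF \<phi>, of 0] by (auto simp: bij_resolvent_iff)
  then have "\<phi> y = - 1" by (simp add: minus_equation_iff)
  then show False using positive_mapD[OF \<phi> y(1)] not_positive_minus_one by metis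
qed

lemma positive_solution_of_spectral_radius_less:
  assumes \<phi>: "positive_map \<phi>" and s: "s > 0" and rad: "spectral_radius \<phi> < s"
  shows "\<exists>w. positive w \<and> \<phi> w = s *\<^sub>R (w - 1)"
proof -
  note lin = positive_map_clinear[OF \<phi>]
  obtain K where K: "\<And>x. norm (\<phi> x) \<le> K * norm x" using positive_map_bounded[OF \<phi>] by blast
  \<comment> \<open>Boundedness is what makes the supremum an upper bound for the spectrum.\<close>
  have bdd: "bdd_above (cmod ` op_spectrum \<phi>)"
    using op_spectrum_bounded[OF lin K] by (auto simp: bdd_above_def)
  have "complex_of_real r \<notin> op_spectrum \<phi>" if "r \<ge> s" for r
  proof
    assume "complex_of_real r \<in> op_spectrum \<phi>"
    then have "cmod (complex_of_real r) \<le> spectral_radius \<phi>"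
      unfolding spectral_radius_def by (intro cSup_upper bdd imageI)
    then show False using rad that s by simp
  qed
  then obtain y where y: "positive y" "s *\<^sub>R y - \<phi> y = 1"
    using positive_solution_of_bij[OF \<phi>, of s] s by (auto simp: bij_resolvent_iff)
  have "\<phi> y = s *\<^sub>R y - 1" using y(2) by (simp add: algebra_simps)
  then have "\<phi> (s *\<^sub>R y) = s *\<^sub>R (s *\<^sub>R y - 1)" by (simp add: clinear_map_scaleR[OF lin])
  moreover have "positive (s *\<^sub>R y)" using y s by (intro positive_scaleR) auto
  ultimately show ?thesis by blast
qed

lemma spectral_radius_less_of_similar:
  assumes \<phi>: "positive_map \<phi>" and \<psi>: "positive_map \<psi>" and sim: "elem_similar \<phi> \<psi>" and less: "onorm \<psi> < s"
  shows "spectral_radius \<phi> < s"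
proof -
  obtain a where a: "cinvertible a" and \<phi>_eq: "\<phi> = alpha_inv a \<circ> \<psi> \<circ> alpha a"
    using sim by (auto simp: elem_similar_def)
  \<comment> \<open>The spectrum of \<phi> is to lie in that of \<psi>, so the similarity is
    inverted by passing to \<open>cinv a\<close>.\<close>
  have "\<psi> = alpha_inv (cinv a) \<circ> \<phi> \<circ> alpha (cinv a)"
    unfolding \<phi>_eq alpha_cinv[OF a] by (simp add: fun_eq_iff alpha_alpha_inv[OF a])
  then have sub: "op_spectrum \<phi> \<subseteq> op_spectrum \<psi>"
    by (rule op_spectrum_similar_subset[OF cinvertible_cinv(1)[OF a]])
  have "spectral_radius \<phi> \<le> onorm \<psi>"
    unfolding spectral_radius_def
  proof (rule cSup_least)
    \<comment> \<open>The least-upper-bound property of \<open>Sup\<close> on the reals presupposes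
      a nonempty set.\<close>
    show "cmod ` op_spectrum \<phi> \<noteq> {}" using op_spectrum_nonempty[OF \<phi>] by simp
    fix r assume "r \<in> cmod ` op_spectrum \<phi>"
    then show "r \<le> onorm \<psi>"
      using sub op_spectrum_bounded[OF positive_map_clinear[OF \<psi>]
          onorm[OF positive_map_bounded_linear[OF \<psi>]]] by blast
  qed
  with less show ?thesis by simp
qed

lemma elem_similar_conj:
  assumes "cinvertible a"
  shows "elem_similar \<phi> (alpha_inv a \<circ> \<phi> \<circ> alpha a)"
  unfolding elem_similar_def
  by (rule exI[of _ "cinv a"])
    (simp add: fun_eq_iff cinvertible_cinv[OF assms] alpha_cinv[OF assms] alpha_alpha_inv[OF assms])

theorem theorem3p2:
  fixes \<phi> :: "'a::cstar_algebra \<Rightarrow> 'a" and s :: real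
  assumes "positive_map \<phi>" and "s > 0"
  shows "(spectral_radius \<phi> < s \<longleftrightarrow> (\<exists>w. positive w \<and> \<phi> w = s *\<^sub>R (w - 1)))
       \<and> (spectral_radius \<phi> < s \<longleftrightarrow>
            (\<exists>v. strictly_positive v \<and> onorm (alpha_inv v \<circ> \<phi> \<circ> alpha v) < s))
       \<and> (spectral_radius \<phi> < s \<longleftrightarrow>
            (\<exists>\<psi>. positive_map \<psi> \<and> elem_similar \<phi> \<psi> \<and> onorm \<psi> < s))"
proof -
  have 12: "\<exists>w. positive w \<and> \<phi> w = s *\<^sub>R (w - 1)" if "spectral_radius \<phi> < s"
    by (rule positive_solution_of_spectral_radius_less[OF assms that])
  have 23: "\<exists>v. strictly_positive v \<and> onorm (alpha_inv v \<circ> \<phi> \<circ> alpha v) < s"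
    if w: "positive w" "\<phi> w = s *\<^sub>R (w - 1)" for w
  proof -
    obtain v K where "strictly_positive v" "0 \<le> K" "K < s"
      and "\<And>x. norm ((alpha_inv v \<circ> \<phi> \<circ> alpha v) x) \<le> K * norm x"
      using similar_contraction[OF assms w] by blast
    then show ?thesis using onorm_bound[of K "alpha_inv v \<circ> \<phi> \<circ> alpha v"] by fastforce
  qed
  have 34: "\<exists>\<psi>. positive_map \<psi> \<and> elem_similar \<phi> \<psi> \<and> onorm \<psi> < s"
    if "strictly_positive v" "onorm (alpha_inv v \<circ> \<phi> \<circ> alpha v) < s" for v
    using positive_map_similar[OF assms(1)] elem_similar_conj that
    unfolding strictly_positive_def by blast
  have 41: "spectral_radius \<phi> < s" if "positive_map \<psi>" "elem_similar \<phi> \<psi>" "onorm \<psi> < s" for \<psi>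
    by (rule spectral_radius_less_of_similar[OF assms(1) that])
  \<comment> \<open>The four implications close a cycle.\<close>
  show ?thesis using 12 23 34 41 by meson
qed

end
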